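(* Let $P$ satisfy (F1), (F2), (F3) and let $J\ge0$. If $\rho$ minimizes $E_J$ locally on $R(\mathbb{R}^3)$ (with respect to the $W^\infty$ distance), then $E_J(\rho)$ is finite and $\rho\in W$. In particular, $E_J$ is $P_\infty(\rho)$-differentiable at $\rho$, and its derivative at $\rho$ is given, for all $\sigma\in P_\infty(\rho)$, by $\sigma\mapsto\int_{\mathbb{R}^3}E_J'(\rho)\,\sigma\,dx$, where $$E_J'(\rho)(x)=A'(\rho(x))-V_\rho(x)-\frac{J^2}{2I^2(\rho)}\,r^2(x-\bar x(\rho)).$$
   Context: Assumptions on the pressure: (F1) $P:[0,\infty)\to[0,\infty)$ is continuous and strictly increasing; (F2) $\lim_{s\to0}P(s)s^{-4/3}=0$; (F3) $\lim_{s\to\infty}P(s)s^{-4/3}=\infty$. Define $A(s)=s\int_0^sP(\tau)\tau^{-2}\,d\tau$ for $s>0$, $A(0)=0$ ($A$ is $C^1$ on $[0,\infty)$). $R(\mathbb{R}^3)=\{\rho\in L^{4/3}(\mathbb{R}^3):\rho\ge0,\ \int\rho\,dx=1\}$; $X=L^{4/3}(\mathbb{R}^3)\cap L^1(\mathbb{R}^3)$; $U(\rho)=\int_{\mathbb{R}^3}A(\rho)\,dx$; $\mathcal U=\{\rho\in X:\rho\ge0,\ U(\rho)<\infty\}$; $W=\{\rho\in \mathcal U:\int\rho\,dx=1\}$. $V_\rho(x)=\int\frac{\rho(y)}{|x-y|}\,dy$, $G(\rho,\rho)=\int V_\rho\rho\,dx$, $r(x)=\sqrt{x_1^2+x_2^2}$,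 center of mass $\bar x(\rho)=\int x\rho\,dx/\int\rho\,dx$, moment of inertia $I(\rho)=\int\rho(x)r^2(x-\bar x(\rho))\,dx$, and $E_J(\rho)=U(\rho)-\frac12G(\rho,\rho)+\frac{J^2}{2I(\rho)}$. $W^\infty(\rho,\kappa)=\inf\|f-g\|_{L^\infty([0,1])}$ over Borel $f,g:[0,1]\to\mathbb{R}^3$ pushing Lebesgue measure on $[0,1]$ forward to $\rho\,dx$, $\kappa\,dx$ respectively. "$\rho$ minimizes $E_J$ locally on $R(\mathbb{R}^3)$" means $\rho\in R(\mathbb{R}^3)$ and there is $\delta>0$ with $E_J(\rho)\le E_J(\kappa)$ for all $\kappa\in R(\mathbb{R}^3)$ with $W^\infty(\rho,\kappa)<\delta$. Admissible perturbations: for $R>0$, $P_R(\rho)$ is the set of $\sigma\in L^\infty(\mathbb{R}^3)$ such that $\sigma(x)=0$ where $\rho(x)>R$ or $|x|>R$, and $\sigma(x)\ge0$ where $\rho(x)<R^{-1}$; $P_\infty(\rho)=\bigcup_{R<\infty}P_R(\rho)$. Differentiability: $P(\rho)=\{\sigma\in X:\exists\,\epsilon>0,\ \rho+t\sigma\in \mathcal U\text{ for }0\le t<\epsilon\}$. For a cone $Q\subset X$, $E_J$ is $Q$-differentiable at $\rho$ if $Q\subset P(\rho)$ and there is a linear functional $l$ on the linear span of $Q$ with $\lim_{t\to0^+}t^{-1}(E_J(\rho+t\sigma)-E_J(\rho))=l(\sigma)$ for all $\sigma\in Q$; $l$ is the derivative. *)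

theory Defs
  imports "HOL-Probability.Probability" "HOL-Library.Function_Algebras"
begin

text \<open>
  Elements of the Lebesgue spaces over \<open>\<real>\<^sup>3\<close> are represented by Borel functions, with
  pointwise (in)equalities between them required almost everywhere. All notions
  below are invariant under changing a representative on a null set.
\<close>

type_synonym space3 = "real ^ 3"

definition Lp_fun :: "real \<Rightarrow> (space3 \<Rightarrow> real) \<Rightarrow> bool" where
  "Lp_fun p f \<longleftrightarrow> f \<in> borel_measurable lborel \<and> integrable lborel (\<lambda>x. \<bar>f x\<bar> powr p)"

definition Linf_norm :: "'a measure \<Rightarrow> ('a \<Rightarrow> 'b::real_normed_vector) \<Rightarrow> ereal" where
  "Linf_norm M f = esssup M (\<lambda>x. ereal (norm (f x)))"

text \<open>The library's \<open>esssup\<close> is infinite on non-measurable functions, so measurability is included.\<close>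

definition Linf_fun :: "(space3 \<Rightarrow> real) \<Rightarrow> bool" where
  "Linf_fun f \<longleftrightarrow> f \<in> borel_measurable lborel \<and> Linf_norm lborel f < \<infinity>"


definition F1 :: "(real \<Rightarrow> real) \<Rightarrow> bool" where
  "F1 p \<longleftrightarrow> (\<forall>s\<ge>0. 0 \<le> p s) \<and> continuous_on {0..} p \<and> strict_mono_on {0..} p"

definition F2 :: "(real \<Rightarrow> real) \<Rightarrow> bool" where
  "F2 p \<longleftrightarrow> ((\<lambda>s. p s * s powr (-4/3)) \<longlongrightarrow> 0) (at_right 0)"

definition F3 :: "(real \<Rightarrow> real) \<Rightarrow> bool" where
  "F3 p \<longleftrightarrow> filterlim (\<lambda>s. p s * s powr (-4/3)) at_top at_top"

text \<open>Only the values at \<open>s \<ge> 0\<close> matter; the formula gives \<open>A 0 = 0\<close>.\<close>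

definition A :: "(real \<Rightarrow> real) \<Rightarrow> real \<Rightarrow> real" where
  "A p s = s * (LINT \<tau>:{0..s}|lborel. p \<tau> / \<tau>\<^sup>2)"

text \<open>\<open>A\<close> is a function on \<open>[0,\<infinity>)\<close>, so its derivative at \<open>0\<close> is one-sided.\<close>

definition A' :: "(real \<Rightarrow> real) \<Rightarrow> real \<Rightarrow> real" where
  "A' p s = vector_derivative (A p) (at s within {0..})"


definition R_set :: "(space3 \<Rightarrow> real) set" where
  "R_set = {\<rho>. Lp_fun (4/3) \<rho> \<and> (AE x in lborel. 0 \<le> \<rho> x) \<and> has_bochner_integral lborel \<rho> 1}"

definition X_set :: "(space3 \<Rightarrow> real) set" where
  "X_set = {\<rho>. Lp_fun (4/3) \<rho> \<and> Lp_fun 1 \<rho>}"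

definition U :: "(real \<Rightarrow> real) \<Rightarrow> (space3 \<Rightarrow> real) \<Rightarrow> ennreal" where
  "U p \<rho> = (\<integral>\<^sup>+x. ennreal (A p (\<rho> x)) \<partial>lborel)"

definition U_set :: "(real \<Rightarrow> real) \<Rightarrow> (space3 \<Rightarrow> real) set" where
  "U_set p = {\<rho> \<in> X_set. (AE x in lborel. 0 \<le> \<rho> x) \<and> U p \<rho> < \<infinity>}"

definition W_set :: "(real \<Rightarrow> real) \<Rightarrow> (space3 \<Rightarrow> real) set" where
  "W_set p = {\<rho> \<in> U_set p. has_bochner_integral lborel \<rho> 1}"

text \<open>
  For \<open>\<rho>\<close> in \<open>L\<^sup>1 \<inter> L\<^bsup>4/3\<^esup>\<close> the integral defining \<open>V \<rho> x\<close> converges for almost every \<open>x\<close>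
  (elsewhere the value is \<open>0\<close> by convention), and \<open>G \<rho> \<rho>\<close> converges absolutely.
\<close>

definition V :: "(space3 \<Rightarrow> real) \<Rightarrow> space3 \<Rightarrow> real" where
  "V \<rho> x = (\<integral>y. \<rho> y / norm (x - y) \<partial>lborel)"

definition G :: "(space3 \<Rightarrow> real) \<Rightarrow> (space3 \<Rightarrow> real) \<Rightarrow> real" where
  "G \<rho> \<sigma> = (\<integral>x. V \<rho> x * \<sigma> x \<partial>lborel)"

definition r :: "space3 \<Rightarrow> real" where
  "r x = sqrt ((x $ 1)\<^sup>2 + (x $ 2)\<^sup>2)"

text \<open>
  The center of mass is taken componentwise because \<open>I\<close> involves only its first two
  components, which may exist when the third does not. If one of these two does not
  exist (and hence defaults to \<open>0\<close>), then \<open>I \<rho> = \<infinity>\<close> for every choice of its value.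
\<close>

definition xbar :: "(space3 \<Rightarrow> real) \<Rightarrow> space3" where
  "xbar \<rho> = (\<chi> i. (\<integral>x. x $ i * \<rho> x \<partial>lborel) / (\<integral>x. \<rho> x \<partial>lborel))"

definition I :: "(space3 \<Rightarrow> real) \<Rightarrow> ennreal" where
  "I \<rho> = (\<integral>\<^sup>+x. ennreal (\<rho> x * (r (x - xbar \<rho>))\<^sup>2) \<partial>lborel)"

text \<open>\<open>U \<rho>\<close> and \<open>I \<rho>\<close> may be infinite, the kinetic term being \<open>0\<close> if \<open>I \<rho> = \<infinity>\<close>.\<close>

definition E :: "(real \<Rightarrow> real) \<Rightarrow> real \<Rightarrow> (space3 \<Rightarrow> real) \<Rightarrow> ereal" where
  "E p J \<rho> = enn2ereal (U p \<rho>) - ereal (1/2 * G \<rho> \<rho>) + enn2ereal (ennreal (J\<^sup>2) / (2 * I \<rho>))"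

definition E' :: "(real \<Rightarrow> real) \<Rightarrow> real \<Rightarrow> (space3 \<Rightarrow> real) \<Rightarrow> space3 \<Rightarrow> real" where
  "E' p J \<rho> x = A' p (\<rho> x) - V \<rho> x
     - enn2real (ennreal (J\<^sup>2) / (2 * (I \<rho>)\<^sup>2)) * (r (x - xbar \<rho>))\<^sup>2"


abbreviation unit_interval_measure :: "real measure" where
  "unit_interval_measure \<equiv> restrict_space lborel {0..1}"

definition pushes_to :: "(real \<Rightarrow> space3) \<Rightarrow> (space3 \<Rightarrow> real) \<Rightarrow> bool" where
  "pushes_to f \<rho> \<longleftrightarrow> f \<in> borel_measurable unit_interval_measure
     \<and> distr unit_interval_measure borel f = density lborel (\<lambda>x. ennreal (\<rho> x))"

definition W_inf :: "(space3 \<Rightarrow> real) \<Rightarrow> (space3 \<Rightarrow> real) \<Rightarrow> ereal" where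
  "W_inf \<rho> \<kappa> = Inf {Linf_norm unit_interval_measure (\<lambda>u. f u - g u) | f g.
      pushes_to f \<rho> \<and> pushes_to g \<kappa>}"

definition minimizes_locally :: "(real \<Rightarrow> real) \<Rightarrow> real \<Rightarrow> (space3 \<Rightarrow> real) \<Rightarrow> bool" where
  "minimizes_locally p J \<rho> \<longleftrightarrow> \<rho> \<in> R_set \<and>
     (\<exists>\<delta>>0. \<forall>\<kappa>\<in>R_set. W_inf \<rho> \<kappa> < ereal \<delta> \<longrightarrow> E p J \<rho> \<le> E p J \<kappa>)"


definition P_R :: "real \<Rightarrow> (space3 \<Rightarrow> real) \<Rightarrow> (space3 \<Rightarrow> real) set" where
  "P_R R \<rho> = {\<sigma>. Linf_fun \<sigma>
     \<and> (AE x in lborel. \<rho> x > R \<or> norm x > R \<longrightarrow> \<sigma> x = 0)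
     \<and> (AE x in lborel. \<rho> x < inverse R \<longrightarrow> \<sigma> x \<ge> 0)}"

definition P_inf :: "(space3 \<Rightarrow> real) \<Rightarrow> (space3 \<Rightarrow> real) set" where
  "P_inf \<rho> = (\<Union>R\<in>{0<..}. P_R R \<rho>)"

definition P_dirs :: "(real \<Rightarrow> real) \<Rightarrow> (space3 \<Rightarrow> real) \<Rightarrow> (space3 \<Rightarrow> real) set" where
  "P_dirs p \<rho> = {\<sigma> \<in> X_set. \<exists>\<epsilon>>0. \<forall>t. 0 \<le> t \<and> t < \<epsilon> \<longrightarrow> (\<lambda>x. \<rho> x + t * \<sigma> x) \<in> U_set p}"

definition fun_scale :: "real \<Rightarrow> (space3 \<Rightarrow> real) \<Rightarrow> space3 \<Rightarrow> real" where
  "fun_scale c f = (\<lambda>x. c * f x)"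

abbreviation fun_span :: "(space3 \<Rightarrow> real) set \<Rightarrow> (space3 \<Rightarrow> real) set" where
  "fun_span \<equiv> module.span fun_scale"

definition fun_cone :: "(space3 \<Rightarrow> real) set \<Rightarrow> bool" where
  "fun_cone Q \<longleftrightarrow> (\<forall>f\<in>Q. \<forall>c\<ge>0. fun_scale c f \<in> Q)"

text \<open>The second condition makes \<open>l\<close> well defined on classes of almost everywhere equal functions.\<close>

definition linear_functional_on :: "(space3 \<Rightarrow> real) set \<Rightarrow> ((space3 \<Rightarrow> real) \<Rightarrow> real) \<Rightarrow> bool" where
  "linear_functional_on S l \<longleftrightarrow>
     (\<forall>f\<in>S. \<forall>g\<in>S. \<forall>a b. l (\<lambda>x. a * f x + b * g x) = a * l f + b * l g) \<and>
     (\<forall>f\<in>S. \<forall>g\<in>S. (AE x in lborel. f x = g x) \<longrightarrow> l f = l g)"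

text \<open>
  The difference quotient is taken in the extended reals; its convergence to a real
  number forces \<open>E p J \<rho>\<close> and the nearby values along each ray to be finite.
\<close>

definition has_E_derivative ::
  "(real \<Rightarrow> real) \<Rightarrow> real \<Rightarrow> (space3 \<Rightarrow> real) set \<Rightarrow> (space3 \<Rightarrow> real) \<Rightarrow> ((space3 \<Rightarrow> real) \<Rightarrow> real) \<Rightarrow> bool" where
  "has_E_derivative p J Q \<rho> l \<longleftrightarrow>
     Q \<subseteq> X_set \<and> fun_cone Q \<and> Q \<subseteq> P_dirs p \<rho> \<and> linear_functional_on (fun_span Q) l \<and>
     (\<forall>\<sigma>\<in>Q. ((\<lambda>t. (E p J (\<lambda>x. \<rho> x + t * \<sigma> x) - E p J \<rho>) / ereal t) \<longlongrightarrow> ereal (l \<sigma>)) (at_right 0))"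

definition E_differentiable ::
  "(real \<Rightarrow> real) \<Rightarrow> real \<Rightarrow> (space3 \<Rightarrow> real) set \<Rightarrow> (space3 \<Rightarrow> real) \<Rightarrow> bool" where
  "E_differentiable p J Q \<rho> \<longleftrightarrow> (\<exists>l. has_E_derivative p J Q \<rho> l)"

end

theory Submission
  imports Defs
begin

text \<open>
  Finiteness: averaging \<open>\<rho>\<close> over balls of radius \<open>d\<close> gives a bounded density \<open>\<kappa>\<close>, hence one of
  finite internal energy, and the density \<open>\<rho> x / \<bar>B\<^sub>d\<bar>\<close> on \<open>{(x, y). \<bar>x - y\<bar> < d}\<close> couples \<open>\<rho>\<close>
  with \<open>\<kappa>\<close>. Realizing this coupling as the image of Lebesgue measure on \<open>[0, 1]\<close> shows
  \<open>W_inf \<rho> \<kappa> \<le> d\<close>, so local minimality forces \<open>E \<rho> \<le> E \<kappa> < \<infinity>\<close>.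

  Derivative: along an admissible direction \<open>\<sigma>\<close> the internal energy is differentiated by dominated
  convergence, since \<open>\<rho>\<close> is bounded where \<open>\<sigma> \<noteq> 0\<close> and \<open>A\<close> is Lipschitz on bounded intervals;
  \<open>G\<close> is a bounded quadratic form on \<open>L\<^sup>1 \<inter> L\<^bsup>4/3\<^esup>\<close>; and \<open>I (\<rho> + t \<sigma>)\<close> is an explicit rational
  function of \<open>t\<close> if \<open>I \<rho> < \<infinity>\<close>, while it is infinite for all small \<open>t\<close> otherwise.
\<close>

section \<open>Thermodynamics of the pressure law\<close>

text \<open>A local minimizer may a priori have infinite energy, so a nearby competitor of finite
  energy is needed before anything can be differentiated. Closeness in \<open>W_inf\<close> bounds
  the displacement of almost all mass, so the excess of a high density has to be redistributed
  within distance \<open>d\<close>; local averaging does this. Since \<open>W_inf\<close> is defined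
  through pairs of maps on \<open>[0, 1]\<close>, a coupling is usable only as the image of such a
  map; a Borel injection of space into the line with a Borel left inverse reduces this to quantile
  functions. On bounded intervals (F1) and (F2) give \<open>p s <= C * s powr (4/3)\<close>, which
  makes \<open>p \<tau> / \<tau>^2\<close> integrable at 0 and keeps \<open>A'\<close> bounded
  there. At vacuum \<open>A\<close> has only a one-sided derivative; this suffices because
  admissible directions are nonnegative where \<open>\<rho>\<close> is small. Finiteness of
  \<open>G\<close> rests on an elementary inequality in place of Hardy-Littlewood-Sobolev, and
  finiteness of the kinetic term on the fact that a density cannot concentrate on an axis.\<close>

lemma F1D:
  assumes "F1 p"
  shows "0 \<le> s \<Longrightarrow> 0 \<le> p s" and "continuous_on {0..} p" and "0 \<le> s \<Longrightarrow> s \<le> t \<Longrightarrow> p s \<le> p t"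
  using assms unfolding F1_def strict_mono_on_def by (auto simp: le_less)

text \<open>(F2) controls \<open>p\<close> only near 0; on the rest of \<open>[0, K]\<close>
  monotonicity bounds \<open>p\<close> by \<open>p K\<close>, at the price of a constant depending
  on \<open>K\<close>.\<close>

lemma pressure_growth:
  assumes F1: "F1 p" and F2: "F2 p"
  obtains C where "C > 0" "\<And>s. 0 \<le> s \<Longrightarrow> s \<le> K \<Longrightarrow> p s \<le> C * s powr (4/3)"
proof -
  have "eventually (\<lambda>s. dist (p s * s powr (-4/3)) 0 < 1) (at_right 0)"
    using F2 unfolding F2_def by (rule tendstoD) simp
  then obtain d where d: "d > 0" "\<And>s. 0 < s \<Longrightarrow> s < d \<Longrightarrow> \<bar>p s * s powr (-4/3)\<bar> < 1"
    unfolding eventually_at_right_field by (auto simp: dist_real_def)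
  have small: "p s \<le> s powr (4/3)" if "0 < s" "s < d" for s
  proof -
    have "p s * s powr (-4/3) < 1" using d(2)[OF that] by linarith
    then have "p s * (s powr (-4/3) * s powr (4/3)) \<le> s powr (4/3)"
      using that by (simp add: mult.assoc[symmetric])
    moreover have "s powr (-4/3) * s powr (4/3) = 1"
      using that powr_add[of s "-4/3" "4/3"] by simp
    ultimately show ?thesis by simp
  qed
  \<comment> \<open>At \<open>s = 0\<close> the claimed bound is 0, so \<open>p 0\<close> must
    vanish; this follows by letting \<open>s\<close> tend to 0 in
    \<open>p 0 <= p s <= s powr (4/3)\<close>.\<close>
  have p0: "p 0 \<le> 0"
  proof (rule tendsto_lowerbound)
    show "((\<lambda>s::real. s powr (4/3)) \<longlongrightarrow> 0) (at_right 0)"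
      by (intro tendsto_eq_intros) (auto simp: eventually_at_right_field intro: exI[of _ 1])
    show "\<forall>\<^sub>F s in at_right 0. p 0 \<le> s powr (4/3)"
      unfolding eventually_at_right_field
    proof (intro exI[of _ d] conjI allI impI)
      fix s assume "0 < s" "s < d"
      then show "p 0 \<le> s powr (4/3)" using small[of s] F1D(3)[OF F1, of 0 s] by auto
    qed (use d in auto)
  qed simp
  \<comment> \<open>The summand 1 serves \<open>s < d\<close>; the other makes
    \<open>C * d powr (4/3)\<close> exceed \<open>p K\<close>, which serves
    \<open>s >= d\<close>.\<close>
  define C where "C = 1 + p K / d powr (4/3)"
  show thesis
  proof (cases "K \<ge> 0")
    case True
    have pK: "0 \<le> p K" using F1D(1)[OF F1 True] .
    have C: "C \<ge> 1" "C * d powr (4/3) \<ge> p K" using pK d by (auto simp: C_def field_simps)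
    show thesis
    proof
      show "C > 0" using C by simp
      fix s assume s: "0 \<le> s" "s \<le> K"
      consider "s = 0" | "0 < s" "s < d" | "d \<le> s" using s by linarith
      then show "p s \<le> C * s powr (4/3)"
      proof cases
        case 1 then show ?thesis using p0 by simp
      next
        case 2
        have "s powr (4/3) \<le> C * s powr (4/3)"
          using mult_right_mono[OF C(1) powr_ge_zero, of s "4/3"] by (simp only: mult_1)
        then show ?thesis using small[OF 2] by (rule order_trans[rotated])
      next
        case 3
        have "p s \<le> p K" using F1D(3)[OF F1] s by blast
        also have "\<dots> \<le> C * d powr (4/3)" by (rule C)
        also have "\<dots> \<le> C * s powr (4/3)" using C 3 d by (intro mult_left_mono powr_mono2) auto
        finally show ?thesis .
      qed
    qed
  qed (use that[of 1] in auto)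
qed

text \<open>The internal energy per unit mass, \<open>A p s / s\<close>, in a form that is
  meaningful at \<open>s = 0\<close>. For \<open>s < 0\<close> the interval is empty and the value
  is 0, so the function is monotone on the whole line.\<close>

definition specific_A :: "(real \<Rightarrow> real) \<Rightarrow> real \<Rightarrow> real" where
  "specific_A p s = (LINT \<tau>:{0..s}|lborel. p \<tau> / \<tau>\<^sup>2)"

lemma A_eq: "A p s = s * specific_A p s"
  by (simp add: A_def specific_A_def)

context
  fixes p assumes F1: "F1 p" and F2: "F2 p"
begin

text \<open>By \<open>pressure_growth\<close> the integrand is at most
  \<open>C * x powr (-2/3)\<close>, which is integrable at 0.\<close>

lemma set_integrable_pressure: "set_integrable lborel {0..s} (\<lambda>\<tau>. p \<tau> / \<tau>\<^sup>2)"
proof -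
  obtain C where C: "C > 0" "\<And>t. 0 \<le> t \<Longrightarrow> t \<le> s \<Longrightarrow> p t \<le> C * t powr (4/3)"
    using pressure_growth[OF F1 F2] by metis
  have mp: "(\<lambda>x. indicator {0..s} x * p x) \<in> borel_measurable borel"
    using borel_measurable_continuous_on_indicator[of "{0..s}" p] 
      continuous_on_subset[OF F1D(2)[OF F1], of "{0..s}"] by auto
  have m: "(\<lambda>x. indicator {0..s} x *\<^sub>R (p x / x\<^sup>2)) \<in> borel_measurable lborel"
  proof -
    have "(\<lambda>x. (indicator {0..s} x * p x) / x\<^sup>2) \<in> borel_measurable borel"
      using mp by measurable
    then show ?thesis by simp
  qed
  show ?thesis
  proof (cases "s \<ge> 0")
    case True
    have "(\<lambda>x. C * x powr (-2/3)) integrable_on {0..s}"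
      by (intro integrable_on_mult_right integrable_on_powr_from_0) (use True in auto)
    then have "(\<lambda>x. C * x powr (-2/3)) absolutely_integrable_on {0..s}"
      using C by (intro nonnegative_absolutely_integrable_1) auto
    then have "integrable lborel (\<lambda>x. indicator {0..s} x *\<^sub>R (C * x powr (-2/3)))"
      unfolding set_integrable_def by (subst (asm) integrable_completion) auto
    then show ?thesis unfolding set_integrable_def
    proof (rule Bochner_Integration.integrable_bound[OF _ m], intro AE_I2)
      fix x
      show "norm (indicator {0..s} x *\<^sub>R (p x / x\<^sup>2)) \<le> norm (indicator {0..s} x *\<^sub>R (C * x powr (-2/3)))"
      proof (cases "0 < x \<and> x \<le> s")
        case True
        have "p x / x\<^sup>2 \<le> C * x powr (4/3) / x\<^sup>2" using C True by (intro divide_right_mono) auto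
        also have "\<dots> = C * (x powr (4/3) / x powr 2)" using True by (simp add: powr_numeral)
        also have "\<dots> = C * x powr (-2/3)" by (simp add: powr_diff[symmetric])
        finally show ?thesis using True C F1D(1)[OF F1, of x] by (simp add: abs_mult)
      qed (auto simp: indicator_def not_less le_less)
    qed
  qed (simp add: set_integrable_def)
qed

lemma specific_A_eq_integral: "specific_A p s = integral {0..s} (\<lambda>\<tau>. p \<tau> / \<tau>\<^sup>2)"
  unfolding specific_A_def using set_borel_integral_eq_integral(2)[OF set_integrable_pressure] .

lemma pressure_integrable_on: "(\<lambda>\<tau>. p \<tau> / \<tau>\<^sup>2) integrable_on {0..s}"
  using set_borel_integral_eq_integral(1)[OF set_integrable_pressure] .

lemma specific_A_nonneg: "0 \<le> specific_A p s"
  unfolding specific_A_eq_integral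
  by (rule integral_nonneg[OF pressure_integrable_on]) (auto intro!: divide_nonneg_nonneg F1D(1)[OF F1])

lemma specific_A_mono: "s \<le> t \<Longrightarrow> specific_A p s \<le> specific_A p t"
  unfolding specific_A_eq_integral
  by (rule integral_subset_le[OF _ pressure_integrable_on pressure_integrable_on])
     (auto intro!: divide_nonneg_nonneg F1D(1)[OF F1])

lemma A_nonneg: "0 \<le> s \<Longrightarrow> 0 \<le> A p s"
  by (simp add: A_eq specific_A_nonneg)

text \<open>Converts a pointwise bound on a density into a bound on its internal energy by its
  mass.\<close>

lemma A_le_linear: "0 \<le> s \<Longrightarrow> s \<le> K \<Longrightarrow> A p s \<le> specific_A p K * s"
  using specific_A_mono[of s K] by (simp add: A_eq mult.commute mult_left_mono)

section \<open>Differentiability of \<open>A\<close> on the closed half line\<close>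

lemma specific_A_has_derivative:
  assumes "s > 0"
  shows "(specific_A p has_real_derivative p s / s\<^sup>2) (at s)"
proof -
  have cp: "continuous (at s) p"
  proof -
    have "continuous_on {0<..} p" by (rule continuous_on_subset[OF F1D(2)[OF F1]]) auto
    then show ?thesis using assms by (simp add: continuous_on_eq_continuous_at)
  qed
  have "((\<lambda>u. integral {0..u} (\<lambda>\<tau>. p \<tau> / \<tau>\<^sup>2)) has_vector_derivative p s / s\<^sup>2) (at s within ({0..s+1} - {}))"
  proof (rule integral_has_vector_derivative_continuous_at[OF pressure_integrable_on])
    show "continuous (at s within {0..s + 1} - {}) (\<lambda>\<tau>. p \<tau> / \<tau>\<^sup>2)"
      by (rule continuous_at_imp_continuous_at_within, intro continuous_divide cp continuous_power
            continuous_ident) (use assms in auto)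
  qed (use assms in auto)
  moreover have "at s within ({0..s+1} - {}) = at s"
    using assms by (intro at_within_interior) auto
  ultimately show ?thesis
    unfolding has_real_derivative_iff_has_vector_derivative specific_A_eq_integral[abs_def]
    by simp
qed

lemma A_has_derivative_pos:
  assumes "s > 0"
  shows "(A p has_real_derivative specific_A p s + p s / s) (at s)"
proof -
  have "((\<lambda>s. s * specific_A p s) has_real_derivative 1 * specific_A p s + p s / s\<^sup>2 * s) (at s)"
    by (rule DERIV_mult[OF DERIV_ident specific_A_has_derivative[OF assms]])
  then show ?thesis using assms by (simp add: A_eq[abs_def] power2_eq_square)
qed

text \<open>The difference quotient of \<open>A p\<close> at 0 is \<open>specific_A p s\<close>
  itself, an indefinite integral that is continuous and vanishes at 0.\<close>

lemma A_has_derivative_0: "(A p has_real_derivative 0) (at 0 within {0..})"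
proof -
  have "continuous_on {0..1} (specific_A p)"
    unfolding specific_A_eq_integral[abs_def]
    by (rule indefinite_integral_continuous_1[OF pressure_integrable_on])
  then have "(specific_A p \<longlongrightarrow> specific_A p 0) (at 0 within {0..1})"
    by (simp add: continuous_on_def)
  moreover have "at (0::real) within {0..1} = at 0 within {0..}"
    by (rule at_within_nhd[of _ "{..<1}"]) auto
  moreover have "specific_A p 0 = 0"
    by (simp add: specific_A_eq_integral)
  ultimately have "(specific_A p \<longlongrightarrow> 0) (at 0 within {0..})" by simp
  then show ?thesis
    unfolding has_field_derivative_iff
    by (rule Lim_transform_eventually) (auto simp: A_eq eventually_at_filter)
qed

lemma A'_eq: "s > 0 \<Longrightarrow> A' p s = specific_A p s + p s / s" "A' p 0 = 0"
proof -
  \<comment> \<open>A derivative determines \<open>vector_derivative\<close> only along a nontrivial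
    filter.\<close>
  have nb: "at s within {0..} \<noteq> bot" if "s \<ge> 0" for s :: real
  proof -
    have "at s within {s..} \<le> at s within {0..}" using that by (intro at_le) auto
    moreover have "at s within {s..} \<noteq> bot"
      using trivial_limit_at_right_real[of s] by (simp add: at_within_Ici_at_right)
    ultimately show ?thesis by (metis bot.extremum_uniqueI)
  qed
  show "s > 0 \<Longrightarrow> A' p s = specific_A p s + p s / s"
    unfolding A'_def using A_has_derivative_pos[of s]
    by (intro vector_derivative_within nb)
       (auto simp: has_real_derivative_iff_has_vector_derivative intro: has_vector_derivative_at_within)
  show "A' p 0 = 0"
    unfolding A'_def using A_has_derivative_0
    by (intro vector_derivative_within nb)
       (auto simp: has_real_derivative_iff_has_vector_derivative)
qed

lemma A_has_derivative: "s \<ge> 0 \<Longrightarrow> (A p has_real_derivative A' p s) (at s within {0..})"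
  using A_has_derivative_pos[of s] A_has_derivative_0
  by (cases "s = 0") (auto simp: A'_eq intro: has_field_derivative_at_within)

text \<open>Chain rule along the ray \<open>a + t * s\<close>. As the ray stays in
  \<open>[0, \<infinity>)\<close>, the one-sided derivative is enough when
  \<open>a = 0\<close>.\<close>

lemma A_difference_quotient_tendsto:
  assumes "0 \<le> a" "\<And>t. 0 \<le> t \<Longrightarrow> t \<le> e \<Longrightarrow> 0 \<le> a + t * s" "0 < e"
  shows "((\<lambda>t. (A p (a + t * s) - A p a) / t) \<longlongrightarrow> A' p a * s) (at_right 0)"
proof -
  let ?g = "\<lambda>t. a + t * s"
  have "(A p has_real_derivative A' p (?g 0)) (at (?g 0) within ?g ` {0..e})"
    using A_has_derivative[OF assms(1)] assms(2)
    by (auto intro: has_field_derivative_subset)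
  moreover have "(?g has_real_derivative s) (at 0 within {0..e})"
    by (auto intro!: derivative_eq_intros)
  ultimately have "(A p \<circ> ?g has_real_derivative A' p (?g 0) * s) (at 0 within {0..e})"
    by (rule DERIV_image_chain)
  then show ?thesis
    using assms(3) by (simp add: has_field_derivative_iff at_within_Icc_at_right)
qed

text \<open>The only term of \<open>A'\<close> that could blow up at 0 is \<open>p s / s\<close>,
  and the growth bound makes it \<open>O(s powr (1/3))\<close>.\<close>

lemma A'_bounded:
  obtains C where "C \<ge> 0" "\<And>s. 0 \<le> s \<Longrightarrow> s \<le> K \<Longrightarrow> \<bar>A' p s\<bar> \<le> C"
proof -
  obtain C where C: "C > 0" "\<And>s. 0 \<le> s \<Longrightarrow> s \<le> K \<Longrightarrow> p s \<le> C * s powr (4/3)"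
    using pressure_growth[OF F1 F2] by metis
  show thesis
  proof
    show "0 \<le> specific_A p K + C * \<bar>K\<bar> powr (1/3)" using specific_A_nonneg C by simp
    fix s assume s: "0 \<le> s" "s \<le> K"
    show "\<bar>A' p s\<bar> \<le> specific_A p K + C * \<bar>K\<bar> powr (1/3)"
    proof (cases "s = 0")
      case True
      then show ?thesis using specific_A_nonneg C by (simp add: A'_eq)
    next
      case False
      then have s0: "s > 0" using s by simp
      have "p s / s \<le> C * s powr (4/3) / s" using C(2) s s0 by (intro divide_right_mono) auto
      also have "\<dots> = C * s powr (1/3)" using s0 powr_add[of s "1/3" 1] by simp
      also have "\<dots> \<le> C * \<bar>K\<bar> powr (1/3)" using C s by (intro mult_left_mono powr_mono2) auto
      finally have "p s / s \<le> C * \<bar>K\<bar> powr (1/3)" .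
      moreover have "0 \<le> p s / s" using F1D(1)[OF F1] s by simp
      ultimately show ?thesis using specific_A_mono[OF s(2)] specific_A_nonneg[of s]
        unfolding A'_eq(1)[OF s0] by linarith
    qed
  qed
qed

lemma A_lipschitz:
  obtains C where "C \<ge> 0" "\<And>s t. \<lbrakk>0 \<le> s; s \<le> K; 0 \<le> t; t \<le> K\<rbrakk> \<Longrightarrow> \<bar>A p s - A p t\<bar> \<le> C * \<bar>s - t\<bar>"
proof -
  obtain C where C: "C \<ge> 0" "\<And>s. 0 \<le> s \<Longrightarrow> s \<le> K \<Longrightarrow> \<bar>A' p s\<bar> \<le> C"
    using A'_bounded by metis
  show thesis
  proof (rule that[OF C(1)])
    fix s t assume st: "0 \<le> s" "s \<le> K" "0 \<le> t" "t \<le> K"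
    have "norm (A p s - A p t) \<le> C * norm (s - t)"
    proof (rule field_differentiable_bound[of "{0..K}"])
      fix z assume z: "z \<in> {0..K}"
      show "(A p has_real_derivative A' p z) (at z within {0..K})"
        by (rule has_field_derivative_subset[OF A_has_derivative]) (use z in auto)
      show "norm (A' p z) \<le> C" using C(2)[of z] z by simp
    qed (use st in auto)
    then show "\<bar>A p s - A p t\<bar> \<le> C * \<bar>s - t\<bar>" by simp
  qed
qed

section \<open>Borel measurability of \<open>A\<close> and \<open>A'\<close>\<close>

lemma specific_A_measurable [measurable]: "specific_A p \<in> borel_measurable borel"
  by (rule borel_measurable_mono) (auto simp: mono_def specific_A_mono)

lemma A_measurable [measurable]: "A p \<in> borel_measurable borel"
  unfolding A_eq[abs_def] by measurable

text \<open>A representative \<open>\<rho>\<close> is nonnegative only almost everywhere, so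
  compositions with \<open>\<rho>\<close> call for measurability at negative arguments too.\<close>

lemma A'_measurable [measurable]: "A' p \<in> borel_measurable borel"
proof -
  \<comment> \<open>For \<open>s < 0\<close> the filter is trivial, so \<open>A'\<close> is an unspecified value independent of \<open>s\<close>.\<close>
  have neg: "A' p s = A' p (-1)" if "s < 0" for s
  proof -
    have "at s within {0..} = bot" "at (-1) within {0..} = (bot :: real filter)"
      using that by (auto simp: at_within_eq_bot_iff)
    then show ?thesis by (simp add: A'_def vector_derivative_def has_vector_derivative_def has_derivative_def bounded_linear_scaleR_left)
  qed
  \<comment> \<open>The indicator is there because \<open>p\<close> is constrained only on
    \<open>[0, \<infinity>)\<close> and could be non-measurable elsewhere.\<close>
  have eq: "A' p = (\<lambda>s. if s < 0 then A' p (-1) else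
      if s = 0 then 0 else specific_A p s + (indicator {0..} s * p s) / s)"
  proof
    fix s :: real
    consider "s < 0" | "s = 0" | "s > 0" by linarith
    then show "A' p s = (if s < 0 then A' p (-1) else
        if s = 0 then 0 else specific_A p s + (indicator {0..} s * p s) / s)"
    proof cases
      case 1
      show ?thesis by (subst neg[OF 1]) (use 1 in simp)
    qed (simp_all add: A'_eq)
  qed
  have "(\<lambda>s. indicator {0..} s * p s) \<in> borel_measurable borel"
    using borel_measurable_continuous_on_indicator[of "{0..}" p] F1D(2)[OF F1] by auto
  note [measurable] = this
  show ?thesis by (subst eq) measurable
qed

end

section \<open>Images of Lebesgue measure on the unit interval\<close>

text \<open>A tail of digits 0 and 1 in base 4 is at most 1/3, so the floor cuts exactly after digit
  \<open>n\<close>. The earlier digits contribute multiples of 4, so the parity is digit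
  \<open>n\<close>. In base 2 the tail could reach 1 and the digits would be ambiguous.\<close>

lemma odd_floor_base4_digit:
  fixes c :: "nat \<Rightarrow> real"
  assumes c: "\<And>n. c n \<in> {0, 1}"
  shows "odd \<lfloor>4 ^ Suc n * (\<Sum>k. c k / 4 ^ Suc k)\<rfloor> \<longleftrightarrow> c n = 1"
proof -
  have sg: "summable (\<lambda>k. 1 / 4 ^ Suc k :: real)"
    using summable_mult[OF summable_geometric[of "1/4 :: real"], of "1/4"] by (simp add: power_divide)
  have s: "summable (\<lambda>k. c k / 4 ^ Suc k)"
  proof (rule summable_comparison_test'[OF sg])
    fix k show "norm (c k / 4 ^ Suc k) \<le> 1 / 4 ^ Suc k" using c[of k] by auto
  qed
  define T where "T = (\<Sum>k. c (k + Suc n) / 4 ^ Suc k)"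
  have sT: "summable (\<lambda>k. c (k + Suc n) / 4 ^ Suc k)"
  proof (rule summable_comparison_test'[OF sg])
    fix k show "norm (c (k + Suc n) / 4 ^ Suc k) \<le> 1 / 4 ^ Suc k" using c[of "k + Suc n"] by auto
  qed
  have T0: "0 \<le> T" unfolding T_def
  proof (rule suminf_nonneg[OF sT])
    fix k show "0 \<le> c (k + Suc n) / 4 ^ Suc k" using c[of "k + Suc n"] by auto
  qed
  have "T \<le> (\<Sum>k. 1 / 4 ^ Suc k)" unfolding T_def
  proof (rule suminf_le[OF _ sT sg])
    fix k show "c (k + Suc n) / 4 ^ Suc k \<le> 1 / 4 ^ Suc k" using c[of "k + Suc n"] by auto
  qed
  also have "(\<Sum>k. 1 / 4 ^ Suc k :: real) = 1/3"
    using suminf_mult[OF summable_geometric[of "1/4 :: real"], of "1/4"] suminf_geometric[of "1/4 :: real"]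
    by (simp add: power_divide)
  finally have T1: "T < 1" by simp
  define b where "b k = (if c k = 1 then 1 else 0 :: int)" for k
  have cb: "c k = of_int (b k)" for k using c[of k] by (auto simp: b_def)
  have tail: "4 ^ Suc n * (\<Sum>k. c (k + Suc n) / 4 ^ Suc (k + Suc n)) = T"
  proof -
    have "(\<Sum>k. c (k + Suc n) / 4 ^ Suc (k + Suc n)) = (\<Sum>k. (1 / 4 ^ Suc n) * (c (k + Suc n) / 4 ^ Suc k))"
      by (intro suminf_cong) (simp add: power_add)
    also have "\<dots> = (1 / 4 ^ Suc n) * T" unfolding T_def by (rule suminf_mult[OF sT])
    finally show ?thesis by simp
  qed
  have head: "4 ^ Suc n * (c k / 4 ^ Suc k) = of_int (b k * 4 ^ (n - k))" if "k \<le> n" for k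
  proof -
    have "(4::real) ^ Suc n = 4 ^ Suc k * 4 ^ (n - k)" using that by (simp flip: power_add)
    then show ?thesis by (simp add: cb)
  qed
  have "4 ^ Suc n * (\<Sum>k. c k / 4 ^ Suc k) = T + 4 ^ Suc n * (\<Sum>k<Suc n. c k / 4 ^ Suc k)"
    by (subst suminf_split_initial_segment[OF s, of "Suc n"]) (simp only: distrib_left tail)
  also have "4 ^ Suc n * (\<Sum>k<Suc n. c k / 4 ^ Suc k) = of_int (\<Sum>k<Suc n. b k * 4 ^ (n - k))"
    unfolding sum_distrib_left of_int_sum by (intro sum.cong refl head) auto
  finally have "\<lfloor>4 ^ Suc n * (\<Sum>k. c k / 4 ^ Suc k)\<rfloor> = (\<Sum>k<Suc n. b k * 4 ^ (n - k))"
    using T0 T1 by (simp add: floor_eq_iff add.commute del: of_int_sum sum.lessThan_Suc)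
  also have "\<dots> = (\<Sum>k<n. b k * 4 ^ (n - k)) + b n" by simp
  finally have eq: "\<lfloor>4 ^ Suc n * (\<Sum>k. c k / 4 ^ Suc k)\<rfloor> = (\<Sum>k<n. b k * 4 ^ (n - k)) + b n" .
  have "even (\<Sum>k<n. b k * 4 ^ (n - k))"
    by (intro dvd_sum) auto
  then show ?thesis unfolding eq by (simp add: b_def)
qed

text \<open>
  The code of a point lists, as base-4 digits, in which rational half-spaces the point lies.
\<close>

lemma borel_code_exists:
  obtains \<phi> :: "'a::euclidean_space \<Rightarrow> real" and \<psi> :: "real \<Rightarrow> 'a"
  where "\<phi> \<in> borel_measurable borel" "\<psi> \<in> borel_measurable borel" "\<And>x. \<psi> (\<phi> x) = x"
proof -
  define S where "S = (Basis :: 'a set) \<times> (\<rat> :: real set)"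
  have S: "countable S"
    unfolding S_def by (intro countable_SIGMA countable_finite[OF finite_Basis] countable_rat)
  obtain i0 :: 'a where "i0 \<in> Basis" using nonempty_Basis by blast
  then have "(i0, 0) \<in> S" by (simp add: S_def)
  then have S': "S \<noteq> {}" by auto
  define e where "e = from_nat_into S"
  have rng: "range e = S" using range_from_nat_into[OF S' S] by (simp add: e_def)
  define c where "c x n = (if snd (e n) < x \<bullet> fst (e n) then 1 else 0 :: real)" for x n
  define \<phi> where "\<phi> x = (\<Sum>n. c x n / 4 ^ Suc n)" for x
  \<comment> \<open>A coordinate is the supremum of the rationals below it; indices belonging to
    other coordinates contribute \<open>-\<infinity>\<close>. Taking the supremum in
    \<open>ereal\<close> makes the decoder defined and measurable at every \<open>t\<close>,
    including those that are not codes.\<close>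
  define \<psi>' where "\<psi>' i t = real_of_ereal (SUP n. if fst (e n) = i \<and> odd \<lfloor>4 ^ Suc n * t\<rfloor> then ereal (snd (e n)) else -\<infinity>)"
    for i :: 'a and t :: real
  define \<psi> where "\<psi> t = (\<Sum>i\<in>Basis. \<psi>' i t *\<^sub>R i)" for t
  have "\<phi> \<in> borel_measurable borel"
    unfolding \<phi>_def c_def by measurable
  moreover have "\<psi> \<in> borel_measurable borel"
    unfolding \<psi>_def \<psi>'_def by measurable
  moreover have "\<psi> (\<phi> x) = x" for x
  proof -
    have dec: "odd \<lfloor>4 ^ Suc n * \<phi> x\<rfloor> \<longleftrightarrow> snd (e n) < x \<bullet> fst (e n)" for n
      unfolding \<phi>_def by (subst odd_floor_base4_digit) (auto simp: c_def)
    have "\<psi>' i (\<phi> x) = x \<bullet> i" if i: "i \<in> Basis" for i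
    proof -
      have "(SUP n. if fst (e n) = i \<and> odd \<lfloor>4 ^ Suc n * \<phi> x\<rfloor> then ereal (snd (e n)) else -\<infinity>) = ereal (x \<bullet> i)"
      proof (rule antisym)
        show "(SUP n. if fst (e n) = i \<and> odd \<lfloor>4 ^ Suc n * \<phi> x\<rfloor> then ereal (snd (e n)) else -\<infinity>) \<le> ereal (x \<bullet> i)"
          unfolding dec by (intro SUP_least) auto
        show "ereal (x \<bullet> i) \<le> (SUP n. if fst (e n) = i \<and> odd \<lfloor>4 ^ Suc n * \<phi> x\<rfloor> then ereal (snd (e n)) else -\<infinity>)"
          (is "_ \<le> ?R")
          unfolding le_SUP_iff
        proof (intro allI impI)
          fix y assume y: "y < ereal (x \<bullet> i)"
          obtain z where z: "y < ereal z" "z < x \<bullet> i" using ereal_dense2[OF y] by auto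
          obtain q where q: "q \<in> \<rat>" "z < q" "q < x \<bullet> i" using Rats_dense_in_real[OF z(2)] by blast
          have "(i, q) \<in> range e" unfolding rng S_def using i q by simp
          then obtain n where n: "e n = (i, q)" by auto
          have "y < ereal q" using z(1) q(2) by (meson ereal_less(2) less_ereal.simps(1) less_trans)
          then show "\<exists>n\<in>UNIV. y < (if fst (e n) = i \<and> odd \<lfloor>4 ^ Suc n * \<phi> x\<rfloor> then ereal (snd (e n)) else -\<infinity>)"
            using q(3) by (intro bexI[of _ n]) (simp_all only: dec n fst_conv snd_conv if_True simp_thms UNIV_I)
        qed
      qed
      then show ?thesis by (simp only: \<psi>'_def real_of_ereal.simps)
    qed
    then show "\<psi> (\<phi> x) = x"
      by (simp add: \<psi>_def euclidean_representation)
  qed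
  ultimately show thesis by (rule that)
qed

text \<open>The code \<open>\<phi>\<close> carries \<open>M\<close> to a law on the line, the
  quantile function of that law has it as its image measure, and \<open>\<psi>\<close> carries it
  back to \<open>M\<close>.\<close>

lemma prob_distr_unit_interval:
  fixes M :: "'a::euclidean_space measure"
  assumes M: "prob_space M" and sets: "sets M = sets borel"
  obtains h where "h \<in> borel_measurable unit_interval_measure" "distr unit_interval_measure borel h = M"
proof -
  obtain \<phi> :: "'a \<Rightarrow> real" and \<psi> where [measurable]: "\<phi> \<in> borel_measurable borel" "\<psi> \<in> borel_measurable borel"
    and inv: "\<And>x. \<psi> (\<phi> x) = x"
    using borel_code_exists by metis
  have [measurable]: "\<phi> \<in> borel_measurable M" using sets by (simp cong: measurable_cong_sets)
  interpret M: prob_space M by (rule M)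
  interpret N: cdf_distribution "distr M borel \<phi>"
    unfolding cdf_distribution_def real_distribution_def real_distribution_axioms_def
    by (auto intro: M.prob_space_distr)
  have I_meas: "N.I \<in> borel_measurable (restrict_space lborel {0<..<1})"
    using N.measurable_CI
    by (simp only: measurable_cong_sets[OF sets_restrict_space_cong[OF sets_lborel] refl])
  \<comment> \<open>The quantile function \<open>N.I\<close> is used on the open interval only; the
    two endpoints are a null set and get an arbitrary value.\<close>
  define q where "q u = (if u \<in> {0<..<1} then N.I u else 0)" for u
  have q_borel[measurable]: "q \<in> borel_measurable borel"
    unfolding q_def using N.measurable_CI by (subst (asm) measurable_restrict_space_iff) auto
  define h where "h u = \<psi> (q u)" for u
  have h: "h \<in> borel_measurable borel" unfolding h_def by measurable
  then have h': "h \<in> borel_measurable unit_interval_measure"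
    by (simp add: measurable_restrict_space1)
  have ae01: "AE u in lborel. u \<in> {0..1} \<longleftrightarrow> u \<in> {0<..<1::real}"
    using AE_lborel_singleton[of 0] AE_lborel_singleton[of 1] by eventually_elim auto
  have "distr unit_interval_measure borel h = M"
  proof (rule measure_eqI)
    show "sets (distr unit_interval_measure borel h) = sets M" using sets by simp
    fix X assume "X \<in> sets (distr unit_interval_measure borel h)"
    then have X[measurable]: "X \<in> sets borel" by simp
    have hX: "h -` X \<in> sets borel" using measurable_sets[OF h X] by simp
    have "emeasure (distr unit_interval_measure borel h) X = emeasure lborel (h -` X \<inter> {0..1})"
      using h' hX by (subst emeasure_distr) (auto simp: emeasure_restrict_space space_restrict_space)
    also have "\<dots> = emeasure lborel (h -` X \<inter> {0<..<1})"
      using hX ae01 by (intro emeasure_eq_AE) auto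
    also have "h -` X \<inter> {0<..<1} = N.I -` (\<psi> -` X) \<inter> {0<..<1}"
      by (auto simp: h_def q_def)
    also have "emeasure lborel \<dots> = emeasure (distr (restrict_space lborel {0<..<1}) borel N.I) (\<psi> -` X)"
    proof -
      have P: "\<psi> -` X \<in> sets borel" using measurable_sets[of \<psi> borel borel X] by simp
      show ?thesis
        by (subst emeasure_distr[OF I_meas P])
           (auto simp: emeasure_restrict_space space_restrict_space Int_ac)
    qed
    also have "\<dots> = emeasure (distr M borel \<phi>) (\<psi> -` X)" by (simp only: N.distr_I_eq_M)
    also have "\<dots> = emeasure M (\<phi> -` (\<psi> -` X) \<inter> space M)"
      using measurable_sets[of \<psi> borel borel X] by (subst emeasure_distr) auto
    also have "\<phi> -` (\<psi> -` X) \<inter> space M = X"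
      using sets_eq_imp_space_eq[OF sets] by (auto simp: inv)
    finally show "emeasure (distr unit_interval_measure borel h) X = emeasure M X" .
  qed
  with h' show thesis by (rule that)
qed

section \<open>Densities of finite internal energy near a given one\<close>

text \<open>The plan with density \<open>k\<close> is the image of \<open>[0, 1]\<close> under some
  \<open>h\<close>. The components of \<open>h\<close> then push forward to the two marginals, and
  the support condition bounds their distance almost everywhere.\<close>

lemma W_inf_le_coupling:
  fixes k :: "space3 \<times> space3 \<Rightarrow> ennreal"
  assumes k [measurable]: "k \<in> borel_measurable (lborel \<Otimes>\<^sub>M lborel)"
    and [measurable]: "\<rho> \<in> borel_measurable lborel" "\<kappa> \<in> borel_measurable lborel"
    and fst_marginal: "\<And>x. (\<integral>\<^sup>+y. k (x, y) \<partial>lborel) = ennreal (\<rho> x)"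
    and snd_marginal: "\<And>y. (\<integral>\<^sup>+x. k (x, y) \<partial>lborel) = ennreal (\<kappa> y)"
    and supp: "\<And>x y. k (x, y) \<noteq> 0 \<Longrightarrow> dist x y \<le> d"
    and mass: "(\<integral>\<^sup>+x. ennreal (\<rho> x) \<partial>lborel) = 1"
  shows "W_inf \<rho> \<kappa> \<le> ereal d"
proof -
  let ?P = "lborel \<Otimes>\<^sub>M lborel :: (space3 \<times> space3) measure"
  let ?M = "density ?P k"
  have sets: "sets ?M = sets borel"
    by (simp add: lborel_prod)
  have space: "space ?M = UNIV" by (simp add: space_pair_measure)
  have "prob_space ?M"
  proof
    have "emeasure ?M (space ?M) = (\<integral>\<^sup>+z. k z \<partial>?P)"
      unfolding space_density
      by (subst emeasure_density[OF k sets.top]) (intro nn_integral_cong, simp)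
    also have "\<dots> = 1"
      by (simp add: lborel.nn_integral_fst[symmetric] fst_marginal mass)
    finally show "emeasure ?M (space ?M) = 1" .
  qed
  then obtain h where h [measurable]: "h \<in> borel_measurable unit_interval_measure"
    and distr_h: "distr unit_interval_measure borel h = ?M"
    using prob_distr_unit_interval[OF _ sets] by metis
  have fs [measurable]: "(fst :: space3 \<times> space3 \<Rightarrow> space3) \<in> borel_measurable borel"
       "(snd :: space3 \<times> space3 \<Rightarrow> space3) \<in> borel_measurable borel"
    by (auto intro!: borel_measurable_continuous_onI continuous_intros)
  have "distr ?M borel fst = density lborel (\<lambda>x. ennreal (\<rho> x))"
  proof (rule measure_eqI)
    fix X assume "X \<in> sets (distr ?M borel fst)"
    then have [measurable]: "X \<in> sets borel" by simp
    have vimage: "fst -` X \<inter> space ?M = X \<times> UNIV" unfolding space by auto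
    have "emeasure (distr ?M borel fst) X = (\<integral>\<^sup>+z. k z * indicator (X \<times> UNIV) z \<partial>?P)"
      by (subst emeasure_distr, simp_all only: vimage) (auto simp: emeasure_density)
    also have "\<dots> = (\<integral>\<^sup>+z. k z * indicator X (fst z) \<partial>?P)"
      by (intro nn_integral_cong) (auto simp: indicator_def)
    also have "\<dots> = (\<integral>\<^sup>+x. (\<integral>\<^sup>+y. k (x, y) * indicator X x \<partial>lborel) \<partial>lborel)"
      by (subst lborel.nn_integral_fst[symmetric]) auto
    also have "\<dots> = emeasure (density lborel (\<lambda>x. ennreal (\<rho> x))) X"
      by (simp add: nn_integral_multc fst_marginal emeasure_density)
    finally show "emeasure (distr ?M borel fst) X = emeasure (density lborel (\<lambda>x. ennreal (\<rho> x))) X" .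
  qed simp
  then have f: "pushes_to (fst \<circ> h) \<rho>"
    unfolding pushes_to_def distr_h[symmetric] by (subst (asm) distr_distr) auto
  have "distr ?M borel snd = density lborel (\<lambda>x. ennreal (\<kappa> x))"
  proof (rule measure_eqI)
    fix X assume "X \<in> sets (distr ?M borel snd)"
    then have [measurable]: "X \<in> sets borel" by simp
    have vimage: "snd -` X \<inter> space ?M = UNIV \<times> X" unfolding space by auto
    have "emeasure (distr ?M borel snd) X = (\<integral>\<^sup>+z. k z * indicator (UNIV \<times> X) z \<partial>?P)"
      by (subst emeasure_distr, simp_all only: vimage) (auto simp: emeasure_density)
    also have "\<dots> = (\<integral>\<^sup>+z. k z * indicator X (snd z) \<partial>?P)"
      by (intro nn_integral_cong) (auto simp: indicator_def)
    also have "\<dots> = (\<integral>\<^sup>+y. (\<integral>\<^sup>+x. k (x, y) * indicator X y \<partial>lborel) \<partial>lborel)"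
      by (subst lborel_pair.nn_integral_snd[symmetric]) auto
    also have "\<dots> = emeasure (density lborel (\<lambda>x. ennreal (\<kappa> x))) X"
      by (simp add: nn_integral_multc snd_marginal emeasure_density)
    finally show "emeasure (distr ?M borel snd) X = emeasure (density lborel (\<lambda>x. ennreal (\<kappa> x))) X" .
  qed simp
  then have g: "pushes_to (snd \<circ> h) \<kappa>"
    unfolding pushes_to_def distr_h[symmetric] by (subst (asm) distr_distr) auto
  have "AE z in ?M. dist (fst z) (snd z) \<le> d"
    by (subst AE_density) (auto simp: supp)
  then have "AE u in unit_interval_measure. dist (fst (h u)) (snd (h u)) \<le> d"
    unfolding distr_h[symmetric] by (rule AE_distrD[OF h])
  then have "Linf_norm unit_interval_measure (\<lambda>u. (fst \<circ> h) u - (snd \<circ> h) u) \<le> ereal d"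
    unfolding Linf_norm_def by (intro esssup_I) (auto simp: dist_norm)
  moreover have "W_inf \<rho> \<kappa> \<le> Linf_norm unit_interval_measure (\<lambda>u. (fst \<circ> h) u - (snd \<circ> h) u)"
    unfolding W_inf_def using f g by (intro Inf_lower) blast
  ultimately show ?thesis by (rule order_trans[rotated])
qed

text \<open>The averaging kernel is at most \<open>1 / v\<close>, with \<open>v\<close> the volume
  of a ball of radius \<open>d\<close>, and \<open>\<rho>\<close> has mass 1; hence the bound
  \<open>1 / v\<close> for \<open>\<kappa>\<close>. All balls of radius \<open>d\<close> have the
  same volume, so the other marginal is \<open>\<rho>\<close>.\<close>

lemma bounded_approx_W_inf:
  assumes \<rho>: "\<rho> \<in> R_set" and d: "d > 0"
  obtains \<kappa> K where "\<kappa> \<in> R_set" "W_inf \<rho> \<kappa> \<le> ereal d" "\<And>x. 0 \<le> \<kappa> x" "\<And>x. \<kappa> x \<le> K"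
proof -
  have [measurable]: "\<rho> \<in> borel_measurable lborel"
    and pos: "AE x in lborel. 0 \<le> \<rho> x" and int: "has_bochner_integral lborel \<rho> 1"
    using \<rho> by (auto simp: R_set_def Lp_fun_def)
  have mass: "(\<integral>\<^sup>+x. ennreal (\<rho> x) \<partial>lborel) = 1"
    using int pos by (simp add: nn_integral_eq_integral has_bochner_integral_iff)
  define v where "v = unit_ball_vol (real DIM(space3)) * d ^ DIM(space3)"
  have v: "v > 0" "\<And>x. emeasure lborel (ball x d :: space3 set) = ennreal v"
    using d by (auto simp: v_def emeasure_ball)
  define k :: "space3 \<times> space3 \<Rightarrow> ennreal" where
    "k z = ennreal (\<rho> (fst z)) * (if dist (fst z) (snd z) < d then ennreal (1 / v) else 0)" for z
  have [measurable]: "k \<in> borel_measurable (lborel \<Otimes>\<^sub>M lborel)"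
    unfolding k_def by measurable
  define \<kappa> where "\<kappa> y = enn2real (\<integral>\<^sup>+x. k (x, y) \<partial>lborel)" for y
  have [measurable]: "\<kappa> \<in> borel_measurable lborel" unfolding \<kappa>_def by measurable
  have le: "(\<integral>\<^sup>+x. k (x, y) \<partial>lborel) \<le> ennreal (1 / v)" for y
  proof -
    have "(\<integral>\<^sup>+x. k (x, y) \<partial>lborel) \<le> (\<integral>\<^sup>+x. ennreal (\<rho> x) * ennreal (1 / v) \<partial>lborel)"
      unfolding k_def by (intro nn_integral_mono) (auto intro!: mult_left_mono)
    also have "\<dots> = ennreal (1 / v)" by (simp add: nn_integral_multc mass)
    finally show ?thesis .
  qed
  have snd: "(\<integral>\<^sup>+x. k (x, y) \<partial>lborel) = ennreal (\<kappa> y)" for y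
    unfolding \<kappa>_def using le[of y] by (subst ennreal_enn2real) (auto simp: less_top[symmetric] top_unique)
  have fst: "(\<integral>\<^sup>+y. k (x, y) \<partial>lborel) = ennreal (\<rho> x)" for x
  proof -
    have "(\<integral>\<^sup>+y. k (x, y) \<partial>lborel) = ennreal (\<rho> x) * (\<integral>\<^sup>+y. ennreal (1 / v) * indicator (ball x d) y \<partial>lborel)"
      unfolding k_def by (subst nn_integral_cmult[symmetric]) (auto intro!: nn_integral_cong simp: indicator_def)
    also have "\<dots> = ennreal (\<rho> x)"
      using v by (simp add: nn_integral_cmult_indicator flip: ennreal_mult'')
    finally show ?thesis .
  qed
  have \<kappa>0: "0 \<le> \<kappa> x" for x by (simp add: \<kappa>_def)
  have \<kappa>1: "\<kappa> x \<le> 1 / v" for x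
    using le[of x] v(1) by (simp add: snd)
  have "(\<integral>\<^sup>+y. ennreal (\<kappa> y) \<partial>lborel) = 1"
    by (simp add: snd[symmetric] lborel_pair.Fubini[of k] fst mass)
  then have int\<kappa>: "has_bochner_integral lborel \<kappa> 1"
    by (intro has_bochner_integral_nn_integral) (auto simp: \<kappa>0)
  \<comment> \<open>Interpolation between the integrable and the bounded: one third of the power is
    absorbed by the sup bound.\<close>
  have "integrable lborel (\<lambda>x. \<bar>\<kappa> x\<bar> powr (4/3))"
  proof (rule Bochner_Integration.integrable_bound)
    show "integrable lborel (\<lambda>x. (1 / v) powr (1/3) * \<kappa> x)"
      using int\<kappa> by (intro integrable_mult_right) (simp add: has_bochner_integral_iff)
    show "AE x in lborel. norm (\<bar>\<kappa> x\<bar> powr (4/3)) \<le> norm ((1 / v) powr (1/3) * \<kappa> x)"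
    proof (intro AE_I2)
      fix x
      have "\<kappa> x powr (4/3) = \<kappa> x powr (1/3) * \<kappa> x"
        using powr_add[of "\<kappa> x" "1/3" 1] \<kappa>0[of x] by simp
      also have "\<dots> \<le> (1 / v) powr (1/3) * \<kappa> x"
        using \<kappa>0[of x] \<kappa>1[of x] by (intro mult_right_mono powr_mono2) auto
      finally show "norm (\<bar>\<kappa> x\<bar> powr (4/3)) \<le> norm ((1 / v) powr (1/3) * \<kappa> x)"
        using \<kappa>0[of x] by simp
    qed
  qed measurable
  then have "\<kappa> \<in> R_set" using int\<kappa> by (simp add: R_set_def Lp_fun_def \<kappa>0)
  moreover have "W_inf \<rho> \<kappa> \<le> ereal d"
    by (rule W_inf_le_coupling[of k, OF _ _ _ fst snd _ mass]) (auto simp: k_def split: if_splits)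
  ultimately show thesis using \<kappa>0 \<kappa>1 by (rule that)
qed

section \<open>Newtonian self-energy\<close>

lemma nn_integral_inverse_square_ball:
  fixes y :: space3
  shows "(\<integral>\<^sup>+x. ennreal (if norm (x - y) < 1 then 1 / (norm (x - y))\<^sup>2 else 0) \<partial>lborel)
    \<le> ennreal (8 * unit_ball_vol 3)"
proof -
  \<comment> \<open>On the shell \<open>2\<^bsup>-n-1\<^esup> \<le> \<bar>x - y\<bar> < 2\<^bsup>-n\<^esup>\<close> the integrand is at most \<open>4\<^bsup>n+1\<^esup>\<close>.\<close>
  have ge: "f n \<le> suminf f" for f :: "nat \<Rightarrow> ennreal" and n
    using sum_le_suminf[of f "{n}"] by simp
  have pt: "ennreal (if norm (x - y) < 1 then 1 / (norm (x - y))\<^sup>2 else 0)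
      \<le> (\<Sum>n. ennreal (4 ^ Suc n) * indicator (ball y ((1/2) ^ n)) x)" (is "_ \<le> suminf ?f") for x
  proof (cases "norm (x - y) < 1 \<and> x \<noteq> y")
    case True
    define s where "s = norm (x - y)"
    have s: "0 < s" "s < 1" using True by (auto simp: s_def)
    \<comment> \<open>The index of the dyadic shell containing \<open>s\<close>; minimality gives
      \<open>s < (1/2) ^ n\<close>, or \<open>s < 1\<close> does when \<open>n = 0\<close>.\<close>
    define n where "n = (LEAST n. (1/2) ^ Suc n \<le> s)"
    have "\<exists>n. (1/2) ^ Suc n \<le> s"
    proof -
      obtain n where "(1/2) ^ n < s" using real_arch_pow_inv[OF s(1), of "1/2"] by auto
      then show ?thesis using s by (intro exI[of _ n]) simp
    qed
    then have n1: "(1/2) ^ Suc n \<le> s" unfolding n_def by (rule LeastI_ex)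
    have n2: "s < (1/2) ^ n"
    proof (cases n)
      case (Suc m)
      then have "m < n" by simp
      then have "\<not> (1/2) ^ Suc m \<le> s" unfolding n_def by (rule not_less_Least)
      then show ?thesis using Suc by (simp add: not_le)
    qed (use s in simp)
    have "1 / s\<^sup>2 \<le> 1 / ((1/2) ^ Suc n)\<^sup>2"
      using n1 by (intro divide_left_mono power_mono mult_pos_pos) (use s in auto)
    also have "\<dots> = 4 ^ Suc n"
    proof -
      have "((1/2 :: real) ^ Suc n)\<^sup>2 = (1/4) ^ Suc n"
        by (simp add: power_mult_distrib[symmetric] power2_eq_square del: power_Suc)
      then show ?thesis by (simp add: power_divide del: power_Suc)
    qed
    finally have "ennreal (if norm (x - y) < 1 then 1 / (norm (x - y))\<^sup>2 else 0) \<le> ?f n"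
      using n2 s True by (simp add: s_def[symmetric] dist_norm norm_minus_commute indicator_def ennreal_leI del: power_Suc)
    also have "?f n \<le> suminf ?f"
      by (rule ge)
    finally show ?thesis .
  next
    case False
    \<comment> \<open>This includes the center \<open>x = y\<close>, where
      \<open>1 / 0 = 0\<close>.\<close>
    then have "ennreal (if norm (x - y) < 1 then 1 / (norm (x - y))\<^sup>2 else 0) = 0" by auto
    then show ?thesis by (simp only: zero_le)
  qed
  have "(\<integral>\<^sup>+x. ennreal (if norm (x - y) < 1 then 1 / (norm (x - y))\<^sup>2 else 0) \<partial>lborel)
      \<le> (\<integral>\<^sup>+x. (\<Sum>n. ennreal (4 ^ Suc n) * indicator (ball y ((1/2) ^ n)) x) \<partial>lborel)"
    by (intro nn_integral_mono pt)
  also have "\<dots> = (\<Sum>n. ennreal (4 ^ Suc n) * emeasure lborel (ball y ((1/2) ^ n)))"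
    by (subst nn_integral_suminf)
       (auto simp: nn_integral_cmult_indicator intro!: borel_measurable_times_ennreal borel_measurable_indicator)
  \<comment> \<open>Dimension three enters here: the volume factor \<open>8^(-n)\<close> beats
    \<open>4^(n+1)\<close> and leaves a geometric series. Its sum is the constant
    \<open>8 * unit_ball_vol 3\<close>; the exact integral has 3 in place of 8.\<close>
  also have "\<dots> = (\<Sum>n. ennreal (4 * unit_ball_vol 3 * (1/2) ^ n))"
  proof (intro suminf_cong)
    fix n
    have "(4::real) ^ n * ((1/2) ^ n) ^ 3 = (1/2) ^ n"
      by (simp add: power3_eq_cube power_mult_distrib[symmetric] flip: mult.assoc)
    then have "4 ^ Suc n * (unit_ball_vol 3 * ((1/2) ^ n) ^ 3) = 4 * unit_ball_vol 3 * (1/2 :: real) ^ n"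
      by simp
    then show "ennreal (4 ^ Suc n) * emeasure lborel (ball y ((1/2) ^ n)) = ennreal (4 * unit_ball_vol 3 * (1/2) ^ n)"
      by (simp add: emeasure_ball ennreal_mult''[symmetric] del: power_Suc)
  qed
  also have "\<dots> = ennreal (8 * unit_ball_vol 3)"
    using sums_mult[OF geometric_sums[of "1/2 :: real"], of "4 * unit_ball_vol 3"]
    by (intro suminf_ennreal_eq) auto
  finally show ?thesis .
qed

lemma integrable_pair_mult:
  fixes a :: "'a::euclidean_space \<Rightarrow> real" and b :: "'b::euclidean_space \<Rightarrow> real"
  assumes a: "integrable lborel a" and b: "integrable lborel b"
  shows "integrable (lborel \<Otimes>\<^sub>M lborel) (\<lambda>(x, y). a x * b y)"
proof -
  have [measurable]: "a \<in> borel_measurable lborel" "b \<in> borel_measurable lborel" using a b by auto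
  show ?thesis
    by (rule lborel_pair.Fubini_integrable) (use a b in \<open>auto simp: abs_mult\<close>)
qed

text \<open>Integrating over \<open>y\<close> first, the kernel contributes at most
  \<open>8 * unit_ball_vol 3\<close> uniformly in \<open>x\<close>, which leaves a multiple of
  \<open>a\<close>.\<close>

lemma integrable_pair_kernel:
  fixes a :: "space3 \<Rightarrow> real"
  assumes a: "integrable lborel a"
  shows "integrable (lborel \<Otimes>\<^sub>M lborel) (\<lambda>(x, y). a x * (if norm (x - y) < 1 then 1 / (norm (x - y))\<^sup>2 else 0))"
proof -
  have [measurable]: "a \<in> borel_measurable lborel" using a by auto
  define h :: "space3 \<Rightarrow> space3 \<Rightarrow> real" where
    "h x y = (if norm (x - y) < 1 then 1 / (norm (x - y))\<^sup>2 else 0)" for x y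
  have h0: "0 \<le> h x y" for x y by (simp add: h_def)
  have [measurable]: "case_prod h \<in> borel_measurable (lborel \<Otimes>\<^sub>M lborel)" unfolding h_def by measurable
  have C: "(\<integral>\<^sup>+y. ennreal (h x y) \<partial>lborel) \<le> ennreal (8 * unit_ball_vol 3)" for x
    using nn_integral_inverse_square_ball[of x] by (simp only: h_def norm_minus_commute[of x])
  have hi: "integrable lborel (h x)" for x
    by (rule integrableI_bounded) (auto simp: h0 le_less_trans[OF C])
  have hb: "(\<integral>y. h x y \<partial>lborel) \<le> 8 * unit_ball_vol 3" for x
    using C[of x] by (subst (asm) nn_integral_eq_integral[OF hi]) (auto simp: h0)
  have "integrable (lborel \<Otimes>\<^sub>M lborel) (\<lambda>(x, y). a x * h x y)"
  proof (rule lborel_pair.Fubini_integrable)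
    show "integrable lborel (\<lambda>x. \<integral>y. norm (case (x, y) of (x, y) \<Rightarrow> a x * h x y) \<partial>lborel)"
    proof (rule Bochner_Integration.integrable_bound)
      show "integrable lborel (\<lambda>x. 8 * unit_ball_vol 3 * a x)" using a by simp
      show "AE x in lborel. norm (\<integral>y. norm (case (x, y) of (x, y) \<Rightarrow> a x * h x y) \<partial>lborel) \<le> norm (8 * unit_ball_vol 3 * a x)"
        using hb by (auto simp: abs_mult h0 mult.commute[of "\<bar>a _\<bar>"] intro!: mult_right_mono)
    qed measurable
  qed (auto simp: hi)
  then show ?thesis by (simp add: h_def)
qed

text \<open>With \<open>a = \<alpha>^3\<close> and \<open>b = \<beta>^3\<close>, the right side
  minus the left is \<open>(\<alpha>^2 \<beta>^2 - \<alpha> \<beta> k)^2 / 2 + k^2 (\<alpha>^2 -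
  \<beta>^2)^2 / 4\<close>.\<close>

lemma triple_product_le:
  fixes a b k :: real
  assumes "0 \<le> a" "0 \<le> b"
  shows "a * b * k \<le> a powr (4/3) * b powr (4/3) / 2 + a powr (4/3) * k\<^sup>2 / 4 + b powr (4/3) * k\<^sup>2 / 4"
proof -
  have root: "(x powr (1/3)) ^ n = x powr (n / 3)" if "n > 0" for x :: real and n :: nat
    using that by (cases "x = 0") (auto simp: powr_power)
  define \<alpha> \<beta> where "\<alpha> = a powr (1/3)" and "\<beta> = b powr (1/3)"
  have a: "a = \<alpha> ^ 3" "a powr (4/3) = \<alpha> ^ 4" and b: "b = \<beta> ^ 3" "b powr (4/3) = \<beta> ^ 4"
    using assms by (auto simp: \<alpha>_def \<beta>_def root)
  have "0 \<le> (\<alpha>\<^sup>2 * \<beta>\<^sup>2 - \<alpha> * \<beta> * k)\<^sup>2" "0 \<le> k\<^sup>2 * (\<alpha>\<^sup>2 - \<beta>\<^sup>2)\<^sup>2" by auto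
  then show ?thesis
    unfolding a(2) b(2) unfolding a(1) b(1) by (simp add: power2_eq_square power3_eq_cube power4_eq_xxxx algebra_simps)
qed

text \<open>
  With \<open>k = 1 / \<bar>x - y\<bar>\<close>, the inequality above bounds the integrand near the diagonal by terms
  integrable on the product space, because \<open>k\<^sup>2\<close> is locally integrable in dimension three.
\<close>

lemma coulomb_integrable:
  assumes f: "f \<in> X_set" and g: "g \<in> X_set"
  shows "integrable (lborel \<Otimes>\<^sub>M lborel) (\<lambda>(x, y). f y * g x / norm (x - y))"
proof -
  have [measurable]: "f \<in> borel_measurable lborel" "g \<in> borel_measurable lborel"
    and f1: "integrable lborel (\<lambda>x. \<bar>f x\<bar>)" and f43: "integrable lborel (\<lambda>x. \<bar>f x\<bar> powr (4/3))"
    and g1: "integrable lborel (\<lambda>x. \<bar>g x\<bar>)" and g43: "integrable lborel (\<lambda>x. \<bar>g x\<bar> powr (4/3))"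
    using f g by (auto simp: X_set_def Lp_fun_def)
  define h :: "space3 \<Rightarrow> space3 \<Rightarrow> real" where
    "h x y = (if norm (x - y) < 1 then 1 / (norm (x - y))\<^sup>2 else 0)" for x y
  \<comment> \<open>The first summand dominates at distance at least 1, where the Coulomb kernel is
    at most 1; the other three dominate at smaller distance.\<close>
  let ?b = "\<lambda>(x, y). \<bar>g x\<bar> * \<bar>f y\<bar> + \<bar>g x\<bar> powr (4/3) * \<bar>f y\<bar> powr (4/3) / 2
     + \<bar>g x\<bar> powr (4/3) * h x y / 4 + \<bar>f y\<bar> powr (4/3) * h x y / 4"
  have h_swap: "h x y = h y x" for x y by (simp add: h_def norm_minus_commute)
  have "integrable (lborel \<Otimes>\<^sub>M lborel) (\<lambda>(x, y). \<bar>f y\<bar> powr (4/3) * h x y)"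
    using lborel_pair.integrable_product_swap[OF integrable_pair_kernel[OF f43]]
    by (simp add: h_def norm_minus_commute cong: if_cong)
  then have b: "integrable (lborel \<Otimes>\<^sub>M lborel) ?b"
    using integrable_pair_mult[OF g1 f1] integrable_pair_mult[OF g43 f43] integrable_pair_kernel[OF g43]
    unfolding split_beta' h_def[symmetric] by simp
  show ?thesis
  proof (rule Bochner_Integration.integrable_bound[OF b])
    show "AE z in lborel \<Otimes>\<^sub>M lborel. norm (case z of (x, y) \<Rightarrow> f y * g x / norm (x - y)) \<le> norm (?b z)"
    proof (rule AE_I2)
      fix z :: "space3 \<times> space3"
      obtain x y where z: "z = (x, y)" by (cases z)
      have "\<bar>g x\<bar> * \<bar>f y\<bar> * (1 / norm (x - y)) \<le> \<bar>g x\<bar> * \<bar>f y\<bar> + \<bar>g x\<bar> powr (4/3) * \<bar>f y\<bar> powr (4/3) / 2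
          + \<bar>g x\<bar> powr (4/3) * h x y / 4 + \<bar>f y\<bar> powr (4/3) * h x y / 4"
      proof (cases "norm (x - y) < 1")
        case True
        then have h: "h x y = (1 / norm (x - y))\<^sup>2" by (simp add: h_def power_divide)
        have "0 \<le> \<bar>g x\<bar> * \<bar>f y\<bar>" by simp
        then show ?thesis
          using triple_product_le[OF abs_ge_zero abs_ge_zero, of "g x" "f y" "1 / norm (x - y)"]
          unfolding h by linarith
      next
        case False
        then have "\<bar>g x\<bar> * \<bar>f y\<bar> * (1 / norm (x - y)) \<le> \<bar>g x\<bar> * \<bar>f y\<bar> * 1"
          by (intro mult_left_mono) (auto simp: divide_le_eq not_less)
        moreover have h: "h x y = 0" using False by (simp add: h_def)
        moreover have "0 \<le> \<bar>g x\<bar> powr (4/3) * \<bar>f y\<bar> powr (4/3)" by simp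
        ultimately show ?thesis unfolding h by linarith
      qed
      then show "norm (case z of (x, y) \<Rightarrow> f y * g x / norm (x - y)) \<le> norm (?b z)"
        unfolding z prod.case real_norm_def
        by (intro order_trans[OF _ abs_ge_self]) (simp add: abs_mult mult.commute)
    qed
  qed measurable
qed

lemma
  assumes f: "f \<in> X_set" and g: "g \<in> X_set"
  shows integrable_V_mult: "integrable lborel (\<lambda>x. V f x * g x)"
    and G_eq_pair_integral: "G f g = (\<integral>(x, y). f y * g x / norm (x - y) \<partial>(lborel \<Otimes>\<^sub>M lborel))"
proof -
  \<comment> \<open>Valid for every \<open>x\<close>: where the potential diverges, both sides are 0
    by the default value of the integral.\<close>
  have eq: "(\<integral>y. (case (x, y) of (x, y) \<Rightarrow> f y * g x / norm (x - y)) \<partial>lborel) = V f x * g x" for x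
  proof -
    have "(\<integral>y. (case (x, y) of (x, y) \<Rightarrow> f y * g x / norm (x - y)) \<partial>lborel) = (\<integral>y. (f y / norm (x - y)) * g x \<partial>lborel)"
      by (intro Bochner_Integration.integral_cong) auto
    then show ?thesis by (simp only: integral_mult_left_zero V_def)
  qed
  show "integrable lborel (\<lambda>x. V f x * g x)"
    using lborel_pair.integrable_fst'[OF coulomb_integrable[OF f g]] by (simp only: eq)
  show "G f g = (\<integral>(x, y). f y * g x / norm (x - y) \<partial>(lborel \<Otimes>\<^sub>M lborel))"
    using lborel_pair.integral_fst'[OF coulomb_integrable[OF f g]] by (simp only: eq G_def)
qed

lemma G_commute:
  assumes f: "f \<in> X_set" and g: "g \<in> X_set"
  shows "G f g = G g f"
proof -
  have "(\<integral>(x, y). g y * f x / norm (x - y) \<partial>(lborel \<Otimes>\<^sub>M lborel))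
      = (\<integral>(x, y). g x * f y / norm (y - x) \<partial>(lborel \<Otimes>\<^sub>M lborel))"
    using lborel_pair.integral_product_swap[OF borel_measurable_integrable[OF coulomb_integrable[OF g f]]]
    by simp
  then show ?thesis
    by (simp add: G_eq_pair_integral[OF f g] G_eq_pair_integral[OF g f] norm_minus_commute mult.commute)
qed

text \<open>The expansion is carried out under the double integral, where it holds pointwise.
  Linearity of \<open>V\<close> in its density could fail at points where a potential
  diverges.\<close>

lemma G_perturbed:
  assumes f: "f \<in> X_set" and g: "g \<in> X_set" and fg: "(\<lambda>x. f x + t * g x) \<in> X_set"
  shows "G (\<lambda>x. f x + t * g x) (\<lambda>x. f x + t * g x) = G f f + 2 * t * G f g + t\<^sup>2 * G g g"
proof -
  define K where "K u v z = u (snd z) * v (fst z) / norm (fst z - snd z)"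
    for u v :: "space3 \<Rightarrow> real" and z :: "space3 \<times> space3"
  have K: "integrable (lborel \<Otimes>\<^sub>M lborel) (K u v)" "G u v = integral\<^sup>L (lborel \<Otimes>\<^sub>M lborel) (K u v)"
    if "u \<in> X_set" "v \<in> X_set" for u v
    using coulomb_integrable[OF that] G_eq_pair_integral[OF that] by (simp_all add: K_def[abs_def] split_beta')
  have "G (\<lambda>x. f x + t * g x) (\<lambda>x. f x + t * g x)
      = (\<integral>z. K f f z + t * K f g z + t * K g f z + t\<^sup>2 * K g g z \<partial>(lborel \<Otimes>\<^sub>M lborel))"
    unfolding K(2)[OF fg fg]
    by (intro Bochner_Integration.integral_cong)
       (auto simp: K_def divide_inverse algebra_simps power2_eq_square)
  also have "\<dots> = G f f + t * G f g + t * G g f + t\<^sup>2 * G g g"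
    using K f g by simp
  finally show ?thesis using G_commute[OF f g] by simp
qed

section \<open>Admissible perturbations\<close>

lemma Lp_fun_lincomb:
  assumes f: "Lp_fun q f" and g: "Lp_fun q g" and q: "q > 0"
  shows "Lp_fun q (\<lambda>x. f x + t * g x)"
proof -
  have [measurable]: "f \<in> borel_measurable lborel" "g \<in> borel_measurable lborel"
    using f g by (auto simp: Lp_fun_def)
  \<comment> \<open>A sum is at most twice its larger term in absolute value, so this majorant works
    for every \<open>q > 0\<close> without convexity.\<close>
  let ?b = "\<lambda>x. 2 powr q * \<bar>f x\<bar> powr q + (2 * \<bar>t\<bar>) powr q * \<bar>g x\<bar> powr q"
  have "integrable lborel (\<lambda>x. \<bar>f x + t * g x\<bar> powr q)"
  proof (rule Bochner_Integration.integrable_bound)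
    show "integrable lborel ?b" using f g by (simp add: Lp_fun_def)
    show "AE x in lborel. norm (\<bar>f x + t * g x\<bar> powr q) \<le> norm (?b x)"
    proof (rule AE_I2)
      fix x
      have tg: "\<bar>t * g x\<bar> = \<bar>t\<bar> * \<bar>g x\<bar>" by (rule abs_mult)
      have "\<bar>f x + t * g x\<bar> \<le> 2 * \<bar>f x\<bar> \<or> \<bar>f x + t * g x\<bar> \<le> 2 * \<bar>t\<bar> * \<bar>g x\<bar>"
        using abs_triangle_ineq[of "f x" "t * g x"] unfolding tg by linarith
      then have "\<bar>f x + t * g x\<bar> powr q \<le> (2 * \<bar>f x\<bar>) powr q \<or> \<bar>f x + t * g x\<bar> powr q \<le> (2 * \<bar>t\<bar> * \<bar>g x\<bar>) powr q"
        using q by (auto intro: powr_mono2)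
      moreover have "0 \<le> (2 * \<bar>f x\<bar>) powr q" "0 \<le> (2 * \<bar>t\<bar> * \<bar>g x\<bar>) powr q" by auto
      ultimately have "\<bar>f x + t * g x\<bar> powr q \<le> (2 * \<bar>f x\<bar>) powr q + (2 * \<bar>t\<bar> * \<bar>g x\<bar>) powr q" by linarith
      then show "norm (\<bar>f x + t * g x\<bar> powr q) \<le> norm (?b x)"
        by (simp add: powr_mult)
    qed
  qed measurable
  then show ?thesis by (simp add: Lp_fun_def)
qed

lemma X_set_lincomb:
  assumes "f \<in> X_set" "g \<in> X_set"
  shows "(\<lambda>x. f x + t * g x) \<in> X_set"
  using assms by (auto simp: X_set_def intro: Lp_fun_lincomb)

lemma R_set_subset_X_set: "R_set \<subseteq> X_set"
proof
  fix \<rho> assume "\<rho> \<in> R_set"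
  then have \<rho>: "Lp_fun (4/3) \<rho>" "AE x in lborel. 0 \<le> \<rho> x" "has_bochner_integral lborel \<rho> 1"
    by (auto simp: R_set_def)
  have "integrable lborel (\<lambda>x. \<bar>\<rho> x\<bar>)"
    using \<rho>(3) by (auto simp: has_bochner_integral_iff)
  then show "\<rho> \<in> X_set" using \<rho>(1) by (simp add: X_set_def Lp_fun_def)
qed

text \<open>Membership in \<open>P_R R \<rho>\<close> with the support condition in contrapositive
  form and the essential supremum replaced by a positive bound \<open>M\<close>, so that
  \<open>t * M \<le> inverse R\<close> describes a nontrivial range of \<open>t\<close>.\<close>

locale admissible_perturbation =
  fixes \<rho> \<sigma> :: "space3 \<Rightarrow> real" and R M :: real
  assumes \<rho>: "\<rho> \<in> R_set" and \<sigma>_measurable [measurable]: "\<sigma> \<in> borel_measurable lborel"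
    and R_pos: "0 < R" and M_pos: "0 < M"
    and bounded: "AE x in lborel. \<bar>\<sigma> x\<bar> \<le> M"
    and support: "AE x in lborel. \<sigma> x \<noteq> 0 \<longrightarrow> \<rho> x \<le> R \<and> norm x \<le> R"
    and nonneg_on_low: "AE x in lborel. \<rho> x < inverse R \<longrightarrow> 0 \<le> \<sigma> x"
begin

lemma \<rho>_measurable [measurable]: "\<rho> \<in> borel_measurable lborel"
  using \<rho> by (simp add: R_set_def Lp_fun_def)

lemma \<rho>_integral: "integrable lborel \<rho>" "(\<integral>x. \<rho> x \<partial>lborel) = 1"
  using \<rho> by (auto simp: R_set_def has_bochner_integral_iff)

lemma \<rho>_nonneg: "AE x in lborel. 0 \<le> \<rho> x"
  using \<rho> by (simp add: R_set_def)

text \<open>Where \<open>\<rho> x < inverse R\<close> the direction is nonnegative; elsewhere a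
  decrease by at most \<open>t * M \<le> inverse R\<close> is affordable.\<close>

lemma perturbed_nonneg:
  assumes "0 \<le> t" "t * M \<le> inverse R"
  shows "AE x in lborel. 0 \<le> \<rho> x + t * \<sigma> x"
  using bounded nonneg_on_low \<rho>_nonneg
proof eventually_elim
  case (elim x)
  have "t * \<sigma> x \<ge> - (t * M)" using mult_left_mono[of "- M" "\<sigma> x" t] elim assms by auto
  then show ?case using elim assms by (cases "\<rho> x < inverse R") auto
qed

lemma integrable_indicator_cball: "integrable lborel (indicator (cball 0 R :: space3 set) :: _ \<Rightarrow> real)"
  using R_pos by (simp add: emeasure_cball)

text \<open>Off a null set \<open>\<sigma>\<close> is bounded and lives where
  \<open>norm x \<le> R\<close> and \<open>\<rho> x \<le> R\<close>, a set of finite measure, so a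
  bound on \<open>g\<close> there suffices.\<close>

lemma integrable_mult_\<sigma>:
  assumes [measurable]: "g \<in> borel_measurable lborel"
    and g: "AE x in lborel. norm x \<le> R \<and> \<rho> x \<le> R \<longrightarrow> \<bar>g x\<bar> \<le> C"
  shows "integrable lborel (\<lambda>x. g x * \<sigma> x)"
proof (rule Bochner_Integration.integrable_bound)
  show "integrable lborel (\<lambda>x. \<bar>C\<bar> * M * indicator (cball 0 R :: space3 set) x)"
    using integrable_indicator_cball by simp
  show "AE x in lborel. norm (g x * \<sigma> x) \<le> norm (\<bar>C\<bar> * M * indicator (cball 0 R :: space3 set) x)"
    using bounded support g
  proof eventually_elim
    case (elim x)
    show ?case
    proof (cases "\<sigma> x = 0")
      case False
      then have "\<bar>g x\<bar> \<le> \<bar>C\<bar>" "norm x \<le> R" using elim by auto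
      then show ?thesis using elim(1) M_pos by (auto simp: abs_mult intro!: mult_mono)
    qed simp
  qed
qed measurable

lemma \<sigma>_in_X_set: "\<sigma> \<in> X_set"
proof -
  have "integrable lborel (\<lambda>x. \<bar>\<sigma> x\<bar> powr q)" if q: "q > 0" for q
  proof (rule Bochner_Integration.integrable_bound)
    show "integrable lborel (\<lambda>x. M powr q * indicator (cball 0 R :: space3 set) x)"
      using integrable_indicator_cball by simp
    show "AE x in lborel. norm (\<bar>\<sigma> x\<bar> powr q) \<le> norm (M powr q * indicator (cball 0 R :: space3 set) x)"
      using bounded support
    proof eventually_elim
      case (elim x)
      then show ?case using q by (cases "\<sigma> x = 0") (auto intro: powr_mono2)
    qed
  qed measurable
  from this[of "4/3"] this[of 1] show ?thesis by (simp add: X_set_def Lp_fun_def)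
qed

lemma perturbed_in_X_set: "(\<lambda>x. \<rho> x + t * \<sigma> x) \<in> X_set"
  using \<rho> R_set_subset_X_set \<sigma>_in_X_set by (intro X_set_lincomb) auto

end

lemma P_inf_admissible:
  assumes "\<rho> \<in> R_set" "\<sigma> \<in> P_inf \<rho>"
  obtains R M where "admissible_perturbation \<rho> \<sigma> R M"
proof -
  obtain R where R: "R > 0" and \<sigma>: "\<sigma> \<in> P_R R \<rho>" using assms(2) by (auto simp: P_inf_def)
  have [measurable]: "\<sigma> \<in> borel_measurable lborel" and fin: "Linf_norm lborel \<sigma> < \<infinity>"
    using \<sigma> by (auto simp: P_R_def Linf_fun_def)
  obtain M where M: "Linf_norm lborel \<sigma> \<le> ereal M"
    using fin by (cases "Linf_norm lborel \<sigma>") auto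
  have "AE x in lborel. ereal (norm (\<sigma> x)) \<le> Linf_norm lborel \<sigma>"
    unfolding Linf_norm_def by (rule esssup_AE)
  \<comment> \<open>The maximum with 1 keeps the bound positive even for a vanishing
    direction.\<close>
  then have "AE x in lborel. \<bar>\<sigma> x\<bar> \<le> max M 1"
  proof eventually_elim
    case (elim x)
    then have "ereal (norm (\<sigma> x)) \<le> ereal M" using M by (rule order_trans)
    then show ?case by simp
  qed
  moreover have "AE x in lborel. \<sigma> x \<noteq> 0 \<longrightarrow> \<rho> x \<le> R \<and> norm x \<le> R"
  proof -
    have "AE x in lborel. \<rho> x > R \<or> norm x > R \<longrightarrow> \<sigma> x = 0" using \<sigma> by (simp add: P_R_def)
    then show ?thesis by eventually_elim (auto simp: not_less)
  qed
  moreover have "AE x in lborel. \<rho> x < inverse R \<longrightarrow> 0 \<le> \<sigma> x" using \<sigma> by (simp add: P_R_def)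
  ultimately have "admissible_perturbation \<rho> \<sigma> R (max M 1)"
    using R assms(1) by unfold_locales auto
  then show thesis by (rule that)
qed

lemma fun_cone_P_inf: "fun_cone (P_inf \<rho>)"
  unfolding fun_cone_def
proof (intro ballI allI impI)
  fix \<sigma> and c :: real assume "\<sigma> \<in> P_inf \<rho>" and c: "0 \<le> c"
  then obtain R where R: "R > 0" and \<sigma>: "\<sigma> \<in> P_R R \<rho>" by (auto simp: P_inf_def)
  have [measurable]: "\<sigma> \<in> borel_measurable lborel" and fin: "Linf_norm lborel \<sigma> < \<infinity>"
    using \<sigma> by (auto simp: P_R_def Linf_fun_def)
  obtain M where M: "Linf_norm lborel \<sigma> \<le> ereal M"
    using fin by (cases "Linf_norm lborel \<sigma>") auto
  have "AE x in lborel. ereal (norm (\<sigma> x)) \<le> Linf_norm lborel \<sigma>"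
    unfolding Linf_norm_def by (rule esssup_AE)
  then have "AE x in lborel. ereal (norm (fun_scale c \<sigma> x)) \<le> ereal (c * M)"
  proof eventually_elim
    case (elim x)
    then have "ereal (norm (\<sigma> x)) \<le> ereal M" using M by (rule order_trans)
    then show ?case using c by (simp add: fun_scale_def abs_mult mult_left_mono)
  qed
  then have "Linf_norm lborel (fun_scale c \<sigma>) \<le> ereal (c * M)"
    unfolding Linf_norm_def by (intro esssup_I) (auto simp: fun_scale_def)
  then have "Linf_fun (fun_scale c \<sigma>)"
    unfolding Linf_fun_def by (auto simp: fun_scale_def intro: le_less_trans)
  moreover have "AE x in lborel. \<rho> x > R \<or> norm x > R \<longrightarrow> fun_scale c \<sigma> x = 0"
  proof -
    have "AE x in lborel. \<rho> x > R \<or> norm x > R \<longrightarrow> \<sigma> x = 0" using \<sigma> by (simp add: P_R_def)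
    then show ?thesis by eventually_elim (auto simp: fun_scale_def)
  qed
  moreover have "AE x in lborel. \<rho> x < inverse R \<longrightarrow> 0 \<le> fun_scale c \<sigma> x"
  proof -
    have "AE x in lborel. \<rho> x < inverse R \<longrightarrow> 0 \<le> \<sigma> x" using \<sigma> by (simp add: P_R_def)
    then show ?thesis by eventually_elim (auto simp: fun_scale_def c)
  qed
  ultimately have "fun_scale c \<sigma> \<in> P_R R \<rho>" by (simp add: P_R_def)
  then show "fun_scale c \<sigma> \<in> P_inf \<rho>" using R by (auto simp: P_inf_def)
qed

section \<open>Variation of the internal energy\<close>

context admissible_perturbation
begin

context
  fixes p assumes F1: "F1 p" and F2: "F2 p" and U: "U p \<rho> < \<infinity>"
begin

text \<open>Where \<open>\<sigma>\<close> is nonzero, both \<open>\<rho>\<close> and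
  \<open>\<rho> + t * \<sigma>\<close> lie in \<open>[0, R + inverse R]\<close>, on which
  \<open>A\<close> is Lipschitz; elsewhere the difference is 0.\<close>

lemma A_perturbed_diff_le:
  obtains C where "C \<ge> 0" "\<And>t. 0 \<le> t \<Longrightarrow> t * M \<le> inverse R \<Longrightarrow>
    AE x in lborel. \<bar>A p (\<rho> x + t * \<sigma> x) - A p (\<rho> x)\<bar> \<le> C * t * indicator (cball 0 R) x"
proof -
  obtain C where C: "C \<ge> 0" "\<And>s t. \<lbrakk>0 \<le> s; s \<le> R + inverse R; 0 \<le> t; t \<le> R + inverse R\<rbrakk>
      \<Longrightarrow> \<bar>A p s - A p t\<bar> \<le> C * \<bar>s - t\<bar>"
    using A_lipschitz[OF F1 F2, of "R + inverse R"] by blast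
  show thesis
  proof (rule that[of "C * M"])
    show "0 \<le> C * M" using C M_pos by simp
    fix t assume t: "0 \<le> t" "t * M \<le> inverse R"
    show "AE x in lborel. \<bar>A p (\<rho> x + t * \<sigma> x) - A p (\<rho> x)\<bar> \<le> C * M * t * indicator (cball 0 R) x"
      using perturbed_nonneg[OF t] \<rho>_nonneg bounded support
    proof eventually_elim
      case (elim x)
      show ?case
      proof (cases "\<sigma> x = 0")
        case False
        then have x: "\<rho> x \<le> R" "norm x \<le> R" using elim by auto
        have ts: "t * \<sigma> x \<le> t * M" "\<bar>t * \<sigma> x\<bar> \<le> t * M"
          using elim t by (auto simp: abs_mult intro!: mult_left_mono)
        have "\<bar>A p (\<rho> x + t * \<sigma> x) - A p (\<rho> x)\<bar> \<le> C * \<bar>\<rho> x + t * \<sigma> x - \<rho> x\<bar>"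
          using elim x ts t R_pos by (intro C(2)) (auto intro: add_mono)
        also have "\<dots> \<le> C * (t * M)" using ts C by (intro mult_left_mono) auto
        finally show ?thesis using x by (simp add: mult_ac)
      qed (use C M_pos t in auto)
    qed
  qed
qed

lemma integrable_A_perturbed:
  assumes t: "0 \<le> t" "t * M \<le> inverse R"
  shows "integrable lborel (\<lambda>x. A p (\<rho> x + t * \<sigma> x))"
proof -
  note [measurable] = A_measurable[OF F1 F2]
  obtain C where C: "C \<ge> 0" "\<And>t. 0 \<le> t \<Longrightarrow> t * M \<le> inverse R \<Longrightarrow>
    AE x in lborel. \<bar>A p (\<rho> x + t * \<sigma> x) - A p (\<rho> x)\<bar> \<le> C * t * indicator (cball 0 R) x"
    by (rule A_perturbed_diff_le) blast
  have "(\<integral>\<^sup>+x. ennreal (norm (A p (\<rho> x))) \<partial>lborel) = U p \<rho>"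
    unfolding U_def
  proof (rule nn_integral_cong_AE)
    show "AE x in lborel. ennreal (norm (A p (\<rho> x))) = ennreal (A p (\<rho> x))"
      using \<rho>_nonneg by eventually_elim (simp add: A_nonneg[OF F1 F2])
  qed
  then have i0: "integrable lborel (\<lambda>x. A p (\<rho> x))"
    using U by (intro integrableI_bounded) auto
  have "integrable lborel (\<lambda>x. A p (\<rho> x + t * \<sigma> x) - A p (\<rho> x))"
  proof (rule Bochner_Integration.integrable_bound)
    show "integrable lborel (\<lambda>x. C * t * indicator (cball 0 R :: space3 set) x :: real)"
      using integrable_indicator_cball by simp
    show "AE x in lborel. norm (A p (\<rho> x + t * \<sigma> x) - A p (\<rho> x)) \<le> norm (C * t * indicator (cball 0 R :: space3 set) x :: real)"
      using C(2)[OF t] by eventually_elim auto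
  qed measurable
  from Bochner_Integration.integrable_add[OF i0 this] show ?thesis by simp
qed

lemma U_perturbed:
  assumes t: "0 \<le> t" "t * M \<le> inverse R"
  shows "U p (\<lambda>x. \<rho> x + t * \<sigma> x) = ennreal (\<integral>x. A p (\<rho> x + t * \<sigma> x) \<partial>lborel)"
  unfolding U_def
proof (rule nn_integral_eq_integral[OF integrable_A_perturbed[OF t]])
  show "AE x in lborel. 0 \<le> A p (\<rho> x + t * \<sigma> x)"
    using perturbed_nonneg[OF t] by eventually_elim (simp add: A_nonneg[OF F1 F2])
qed

lemma enn2real_U_perturbed:
  assumes t: "0 \<le> t" "t * M \<le> inverse R"
  shows "enn2real (U p (\<lambda>x. \<rho> x + t * \<sigma> x)) = (\<integral>x. A p (\<rho> x + t * \<sigma> x) \<partial>lborel)"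
proof -
  have "AE x in lborel. 0 \<le> A p (\<rho> x + t * \<sigma> x)"
    using perturbed_nonneg[OF t] by eventually_elim (simp add: A_nonneg[OF F1 F2])
  then show ?thesis unfolding U_perturbed[OF t] by (intro enn2real_ennreal integral_nonneg_AE)
qed

lemma perturbed_in_U_set:
  assumes t: "0 \<le> t" "t * M \<le> inverse R"
  shows "(\<lambda>x. \<rho> x + t * \<sigma> x) \<in> U_set p"
  using perturbed_in_X_set perturbed_nonneg[OF t] by (simp add: U_set_def U_perturbed[OF t])

lemma integrable_A'_mult: "integrable lborel (\<lambda>x. A' p (\<rho> x) * \<sigma> x)"
proof -
  note [measurable] = A'_measurable[OF F1 F2]
  obtain C where C: "\<And>s. 0 \<le> s \<Longrightarrow> s \<le> R \<Longrightarrow> \<bar>A' p s\<bar> \<le> C"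
    using A'_bounded[OF F1 F2, of R] by blast
  show ?thesis
  proof (rule integrable_mult_\<sigma>)
    show "AE x in lborel. norm x \<le> R \<and> \<rho> x \<le> R \<longrightarrow> \<bar>A' p (\<rho> x)\<bar> \<le> C"
      using \<rho>_nonneg by eventually_elim (auto intro: C)
  qed measurable
qed

lemma U_difference_quotient_tendsto:
  "((\<lambda>t. (enn2real (U p (\<lambda>x. \<rho> x + t * \<sigma> x)) - enn2real (U p \<rho>)) / t)
    \<longlongrightarrow> (\<integral>x. A' p (\<rho> x) * \<sigma> x \<partial>lborel)) (at_right 0)"
proof -
  note [measurable] = A_measurable[OF F1 F2] A'_measurable[OF F1 F2]
  \<comment> \<open>The largest \<open>t\<close> with \<open>t * M \<le> inverse R\<close>.\<close>
  define e where "e = inverse (R * M)"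
  have e: "0 < e" using R_pos M_pos by (simp add: e_def)
  have te: "t * M \<le> inverse R" if "t \<le> e" for t
  proof -
    have "t * M \<le> e * M" using that M_pos by (intro mult_right_mono) auto
    also have "e * M = inverse R" using M_pos by (simp add: e_def)
    finally show ?thesis .
  qed
  obtain C where C: "C \<ge> 0" "\<And>t. 0 \<le> t \<Longrightarrow> t * M \<le> inverse R \<Longrightarrow>
    AE x in lborel. \<bar>A p (\<rho> x + t * \<sigma> x) - A p (\<rho> x)\<bar> \<le> C * t * indicator (cball 0 R) x"
    by (rule A_perturbed_diff_le) blast
  \<comment> \<open>\<open>perturbed_nonneg\<close> has an exceptional null set depending on
    \<open>t\<close>. A single one for all \<open>t\<close> in \<open>[0, e]\<close> results from
    the endpoints, because \<open>\<rho> x + t * \<sigma> x\<close> is a convex combination of the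
    values at 0 and \<open>e\<close>.\<close>
  have pos: "AE x in lborel. \<forall>t. 0 \<le> t \<longrightarrow> t \<le> e \<longrightarrow> 0 \<le> \<rho> x + t * \<sigma> x"
    using \<rho>_nonneg perturbed_nonneg[of e, OF less_imp_le[OF e] te[OF order_refl]]
  proof eventually_elim
    case (elim x)
    show ?case
    proof (intro allI impI)
      fix t assume t: "0 \<le> t" "t \<le> e"
      have "\<rho> x + t * \<sigma> x = (1 - t / e) * \<rho> x + (t / e) * (\<rho> x + e * \<sigma> x)"
        using e by (simp add: field_simps)
      then show "0 \<le> \<rho> x + t * \<sigma> x" using elim t e by (simp add: divide_le_eq)
    qed
  qed
  have "((\<lambda>t. \<integral>x. (A p (\<rho> x + t * \<sigma> x) - A p (\<rho> x)) / t \<partial>lborel)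
    \<longlongrightarrow> (\<integral>x. A' p (\<rho> x) * \<sigma> x \<partial>lborel)) (at_right 0)"
  proof (rule tendsto_at_right_sequentially[OF e])
    fix S :: "nat \<Rightarrow> real" assume S: "\<And>n. 0 < S n" "\<And>n. S n < e" "S \<longlonglongrightarrow> 0"
    have S': "filterlim S (at_right 0) sequentially"
      using S by (intro tendsto_imp_filterlim_at_right) auto
    show "(\<lambda>n. \<integral>x. (A p (\<rho> x + S n * \<sigma> x) - A p (\<rho> x)) / S n \<partial>lborel) \<longlonglongrightarrow> (\<integral>x. A' p (\<rho> x) * \<sigma> x \<partial>lborel)"
    proof (rule integral_dominated_convergence)
      show "integrable lborel (\<lambda>x. C * indicator (cball 0 R :: space3 set) x)"
        using integrable_indicator_cball by simp
      show "AE x in lborel. (\<lambda>n. (A p (\<rho> x + S n * \<sigma> x) - A p (\<rho> x)) / S n) \<longlonglongrightarrow> A' p (\<rho> x) * \<sigma> x"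
        using pos \<rho>_nonneg
      proof eventually_elim
        case (elim x)
        show ?case
          by (rule filterlim_compose[OF A_difference_quotient_tendsto[OF F1 F2 _ _ e] S']) (use elim in auto)
      qed
      show "AE x in lborel. norm ((A p (\<rho> x + S n * \<sigma> x) - A p (\<rho> x)) / S n) \<le> C * indicator (cball 0 R) x" for n
        using C(2)[of "S n", OF less_imp_le[OF S(1)] te[OF less_imp_le[OF S(2)]]]
      proof eventually_elim
        case (elim x)
        then show ?case using S(1)[of n] by (simp add: divide_le_eq mult_ac)
      qed
    qed measurable
  qed
  then show ?thesis
  proof (rule Lim_transform_eventually)
    have i0: "integrable lborel (\<lambda>x. A p (\<rho> x))"
      using integrable_A_perturbed[of 0] R_pos by simp
    have U0: "enn2real (U p \<rho>) = (\<integral>x. A p (\<rho> x) \<partial>lborel)"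
      using enn2real_U_perturbed[of 0] R_pos by simp
    show "\<forall>\<^sub>F t in at_right 0. (\<integral>x. (A p (\<rho> x + t * \<sigma> x) - A p (\<rho> x)) / t \<partial>lborel)
        = (enn2real (U p (\<lambda>x. \<rho> x + t * \<sigma> x)) - enn2real (U p \<rho>)) / t"
      unfolding eventually_at_right_field
    proof (intro exI[of _ e] conjI allI impI e)
      fix t assume t: "0 < t" "t < e"
      have t': "0 \<le> t" "t * M \<le> inverse R" using t te by auto
      show "(\<integral>x. (A p (\<rho> x + t * \<sigma> x) - A p (\<rho> x)) / t \<partial>lborel)
        = (enn2real (U p (\<lambda>x. \<rho> x + t * \<sigma> x)) - enn2real (U p \<rho>)) / t"
        unfolding U0 enn2real_U_perturbed[OF t']
        using i0 integrable_A_perturbed[OF t'] by simp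
    qed
  qed
qed

end

end

section \<open>Variation of the kinetic energy\<close>

lemma r_power2: "(r x)\<^sup>2 = (x $ 1)\<^sup>2 + (x $ 2)\<^sup>2"
  by (simp add: r_def)

lemma r_measurable [measurable]: "r \<in> borel_measurable borel"
  unfolding r_def[abs_def] by measurable

lemma r_power2_shift: "(r (x - c))\<^sup>2 = (r x)\<^sup>2 - 2 * c $ 1 * x $ 1 - 2 * c $ 2 * x $ 2 + (r c)\<^sup>2"
  unfolding r_power2 by (simp add: power2_eq_square algebra_simps)

text \<open>In each of the two coordinates, with values \<open>u\<close> and \<open>c\<close>, the
  right side minus the left is \<open>(u - 2 * c)^2\<close>.\<close>

lemma r_power2_le_shift: "(r x)\<^sup>2 \<le> 2 * (r (x - c))\<^sup>2 + 2 * (r c)\<^sup>2"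
  using zero_le_power2[of "x $ 1 - 2 * c $ 1"] zero_le_power2[of "x $ 2 - 2 * c $ 2"]
  unfolding r_power2 by (simp add: power2_eq_square algebra_simps)

lemma r_power2_le_norm: "(r x)\<^sup>2 \<le> (norm x)\<^sup>2"
  by (simp add: r_power2 norm_vec_def L2_set_def sum_3)

text \<open>The axis through \<open>c\<close> lies in the null plane where the first coordinate
  equals \<open>c $ 1\<close>.\<close>

lemma AE_r_shift_nonzero: "AE x in lborel. r (x - c) \<noteq> 0"
proof -
  have "negligible {x :: space3. axis 1 1 \<bullet> x = c $ 1}"
    by (rule negligible_hyperplane) (simp add: axis_eq_0_iff)
  moreover have "closed {x :: space3. axis 1 1 \<bullet> x = c $ 1}" by (rule closed_hyperplane)
  ultimately have "{x :: space3. axis 1 1 \<bullet> x = c $ 1} \<in> null_sets lborel"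
    by (auto simp: null_sets_completion_iff negligible_iff_null_sets)
  then show ?thesis
  proof (rule AE_I')
    show "{x \<in> space lborel. \<not> r (x - c) \<noteq> 0} \<subseteq> {x. axis 1 1 \<bullet> x = c $ 1}"
      by (auto simp: r_def inner_axis' add_nonneg_eq_0_iff)
  qed
qed

text \<open>For the two horizontal coordinates, the absolute value is at most
  \<open>1 + (r x)^2\<close>.\<close>

lemma
  fixes g :: "space3 \<Rightarrow> real"
  assumes g: "integrable lborel g" and gr: "integrable lborel (\<lambda>x. g x * (r x)\<^sup>2)"
  shows integrable_first_moment1: "integrable lborel (\<lambda>x. x $ 1 * g x)"
    and integrable_first_moment2: "integrable lborel (\<lambda>x. x $ 2 * g x)"
proof -
  have [measurable]: "g \<in> borel_measurable lborel" using g by auto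
  have *: "integrable lborel (\<lambda>x. x $ i * g x)" if i: "\<And>x. (x $ i)\<^sup>2 \<le> (r x)\<^sup>2" for i :: 3
  proof (rule Bochner_Integration.integrable_bound)
    show "integrable lborel (\<lambda>x. \<bar>g x\<bar> + \<bar>g x * (r x)\<^sup>2\<bar>)" using g gr by simp
    show "AE x in lborel. norm (x $ i * g x) \<le> norm (\<bar>g x\<bar> + \<bar>g x * (r x)\<^sup>2\<bar>)"
    proof (rule AE_I2)
      fix x :: space3
      have "\<bar>x $ i\<bar> \<le> 1 + (x $ i)\<^sup>2"
        using zero_le_power2[of "\<bar>x $ i\<bar> - 1"] by (simp add: power2_eq_square algebra_simps)
      also have "\<dots> \<le> 1 + (r x)\<^sup>2" using i by simp
      finally have "\<bar>x $ i\<bar> * \<bar>g x\<bar> \<le> (1 + (r x)\<^sup>2) * \<bar>g x\<bar>" by (intro mult_right_mono) auto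
      then show "norm (x $ i * g x) \<le> norm (\<bar>g x\<bar> + \<bar>g x * (r x)\<^sup>2\<bar>)"
        by (simp add: abs_mult algebra_simps)
    qed
  qed measurable
  show "integrable lborel (\<lambda>x. x $ 1 * g x)" "integrable lborel (\<lambda>x. x $ 2 * g x)"
    by (rule *, simp add: r_power2)+
qed

lemma
  fixes g :: "space3 \<Rightarrow> real"
  assumes g: "integrable lborel g" and gr: "integrable lborel (\<lambda>x. g x * (r x)\<^sup>2)"
  shows integrable_shifted_moment: "integrable lborel (\<lambda>x. g x * (r (x - c))\<^sup>2)"
    and integral_shifted_moment: "(\<integral>x. g x * (r (x - c))\<^sup>2 \<partial>lborel) = (\<integral>x. g x * (r x)\<^sup>2 \<partial>lborel)
      - 2 * c $ 1 * (\<integral>x. x $ 1 * g x \<partial>lborel) - 2 * c $ 2 * (\<integral>x. x $ 2 * g x \<partial>lborel) + (r c)\<^sup>2 * (\<integral>x. g x \<partial>lborel)"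
proof -
  have eq: "(\<lambda>x. g x * (r (x - c))\<^sup>2) = (\<lambda>x. g x * (r x)\<^sup>2 - 2 * c $ 1 * (x $ 1 * g x) - 2 * c $ 2 * (x $ 2 * g x) + (r c)\<^sup>2 * g x)"
    unfolding r_power2_shift by (simp add: algebra_simps)
  note i = gr integrable_first_moment1[OF g gr] integrable_first_moment2[OF g gr] g
  show "integrable lborel (\<lambda>x. g x * (r (x - c))\<^sup>2)" unfolding eq using i by simp
  show "(\<integral>x. g x * (r (x - c))\<^sup>2 \<partial>lborel) = (\<integral>x. g x * (r x)\<^sup>2 \<partial>lborel)
      - 2 * c $ 1 * (\<integral>x. x $ 1 * g x \<partial>lborel) - 2 * c $ 2 * (\<integral>x. x $ 2 * g x \<partial>lborel) + (r c)\<^sup>2 * (\<integral>x. g x \<partial>lborel)"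
    unfolding eq using i by simp
qed

text \<open>The parallel axis theorem. It expresses \<open>I\<close> through integrals that are
  linear in the density, so along a ray it becomes a rational function of \<open>t\<close>.\<close>

lemma I_eq:
  assumes nonneg: "AE x in lborel. 0 \<le> f x" and f: "integrable lborel f"
    and fr: "integrable lborel (\<lambda>x. f x * (r x)\<^sup>2)" and mass: "(\<integral>x. f x \<partial>lborel) > 0"
  shows "I f = ennreal ((\<integral>x. f x * (r x)\<^sup>2 \<partial>lborel)
    - ((\<integral>x. x $ 1 * f x \<partial>lborel)\<^sup>2 + (\<integral>x. x $ 2 * f x \<partial>lborel)\<^sup>2) / (\<integral>x. f x \<partial>lborel))"
proof -
  have I: "I f = ennreal (\<integral>x. f x * (r (x - xbar f))\<^sup>2 \<partial>lborel)"
    unfolding I_def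
  proof (rule nn_integral_eq_integral[OF integrable_shifted_moment[OF f fr]])
    show "AE x in lborel. 0 \<le> f x * (r (x - xbar f))\<^sup>2" using nonneg by eventually_elim simp
  qed
  have alg: "q - 2 * (a / m) * a - 2 * (b / m) * b + ((a / m)\<^sup>2 + (b / m)\<^sup>2) * m = q - (a\<^sup>2 + b\<^sup>2) / m"
    if "m > 0" for q a b m :: real
    using that by (simp add: field_simps power2_eq_square)
  have "xbar f $ i = (\<integral>x. x $ i * f x \<partial>lborel) / (\<integral>x. f x \<partial>lborel)" for i
    by (simp add: xbar_def)
  then show ?thesis
    unfolding I integral_shifted_moment[OF f fr] r_power2[of "xbar f"] by (simp only: alg[OF mass])
qed

text \<open>The comparison of \<open>r x\<close> with \<open>r (x - c)\<close> works for any
  \<open>c\<close>, so it does not matter whether \<open>xbar f\<close> is a true center of mass or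
  contains default values.\<close>

lemma integrable_moment_if_I_finite:
  assumes nonneg: "AE x in lborel. 0 \<le> f x" and f: "integrable lborel f" and fin: "I f < \<infinity>"
  shows "integrable lborel (\<lambda>x. f x * (r x)\<^sup>2)"
proof -
  have [measurable]: "f \<in> borel_measurable lborel" using f by auto
  have "(\<integral>\<^sup>+x. ennreal (norm (f x * (r (x - xbar f))\<^sup>2)) \<partial>lborel) = I f"
    unfolding I_def
  proof (rule nn_integral_cong_AE)
    show "AE x in lborel. ennreal (norm (f x * (r (x - xbar f))\<^sup>2)) = ennreal (f x * (r (x - xbar f))\<^sup>2)"
      using nonneg by eventually_elim simp
  qed
  then have i: "integrable lborel (\<lambda>x. f x * (r (x - xbar f))\<^sup>2)"
    using fin by (intro integrableI_bounded) auto
  show ?thesis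
  proof (rule Bochner_Integration.integrable_bound)
    show "integrable lborel (\<lambda>x. 2 * (f x * (r (x - xbar f))\<^sup>2) + 2 * (r (xbar f))\<^sup>2 * f x)"
      using i f by simp
    show "AE x in lborel. norm (f x * (r x)\<^sup>2) \<le> norm (2 * (f x * (r (x - xbar f))\<^sup>2) + 2 * (r (xbar f))\<^sup>2 * f x)"
      using nonneg
    proof eventually_elim
      case (elim x)
      have "f x * (r x)\<^sup>2 \<le> f x * (2 * (r (x - xbar f))\<^sup>2 + 2 * (r (xbar f))\<^sup>2)"
        using elim by (intro mult_left_mono r_power2_le_shift)
      then show ?case using elim by (simp add: algebra_simps)
    qed
  qed measurable
qed

text \<open>A density of positive mass cannot vanish almost everywhere off an axis. This keeps the
  kinetic term finite.\<close>

lemma I_nonzero: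
  assumes nonneg: "AE x in lborel. 0 \<le> f x" and f: "integrable lborel f" and mass: "(\<integral>x. f x \<partial>lborel) > 0"
  shows "I f \<noteq> 0"
proof
  assume "I f = 0"
  have [measurable]: "f \<in> borel_measurable lborel" using f by auto
  have "AE x in lborel. ennreal (f x * (r (x - xbar f))\<^sup>2) = 0"
    using \<open>I f = 0\<close> unfolding I_def by (subst (asm) nn_integral_0_iff_AE) auto
  then have "AE x in lborel. f x = 0"
    using nonneg AE_r_shift_nonzero[of "xbar f"]
  proof eventually_elim
    case (elim x)
    then have "f x * (r (x - xbar f))\<^sup>2 \<le> 0" by (simp add: ennreal_eq_0_iff)
    then show "f x = 0" using elim by (auto simp: mult_le_0_iff)
  qed
  then have "(\<integral>x. f x \<partial>lborel) = 0" by (rule integral_eq_zero_AE)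
  then show False using mass by simp
qed

section \<open>The kinetic term along an admissible ray\<close>

definition kinetic :: "real \<Rightarrow> (space3 \<Rightarrow> real) \<Rightarrow> ennreal" where
  "kinetic J f = ennreal (J\<^sup>2) / (2 * I f)"

lemma kinetic_eq_ennreal:
  assumes "I f = ennreal n" "n > 0"
  shows "kinetic J f = ennreal (J\<^sup>2 / (2 * n))"
proof -
  have "2 * ennreal n = ennreal (2 * n)" using assms by (simp add: ennreal_mult)
  then show ?thesis using assms by (simp add: kinetic_def divide_ennreal)
qed

lemma kinetic_finite:
  assumes "AE x in lborel. 0 \<le> f x" "integrable lborel f" "(\<integral>x. f x \<partial>lborel) > 0"
  shows "kinetic J f \<noteq> \<infinity>"
proof (cases "I f = \<infinity>")
  case True
  then show ?thesis by (simp add: kinetic_def ennreal_mult_top)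
next
  case False
  then obtain n where n: "0 \<le> n" "I f = ennreal n" by (cases "I f") auto
  then have "n > 0" using I_nonzero[OF assms] by (auto simp: le_less)
  then show ?thesis using kinetic_eq_ennreal[OF n(2)] by simp
qed

context admissible_perturbation
begin

lemma integrable_r_power2_\<sigma>: "integrable lborel (\<lambda>x. \<sigma> x * (r (x - c))\<^sup>2)"
proof -
  have "(\<lambda>x. (r (x - c))\<^sup>2 * \<sigma> x) = (\<lambda>x. \<sigma> x * (r (x - c))\<^sup>2)" by (simp add: mult.commute)
  moreover have "integrable lborel (\<lambda>x. (r (x - c))\<^sup>2 * \<sigma> x)"
  proof (rule integrable_mult_\<sigma>)
    have "(r (x - c))\<^sup>2 \<le> (R + norm c)\<^sup>2" if "norm x \<le> R" for x
    proof -
      have "norm (x - c) \<le> R + norm c" using norm_triangle_ineq4[of x c] that by linarith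
      then show ?thesis using r_power2_le_norm[of "x - c"] power_mono[of "norm (x - c)" "R + norm c" 2] by simp
    qed
    then show "AE x in lborel. norm x \<le> R \<and> \<rho> x \<le> R \<longrightarrow> \<bar>(r (x - c))\<^sup>2\<bar> \<le> (R + norm c)\<^sup>2" by simp
  qed measurable
  ultimately show ?thesis by simp
qed

lemma integrable_\<sigma>: "integrable lborel \<sigma>"
  using integrable_mult_\<sigma>[of "\<lambda>_. 1" 1] by simp

text \<open>An admissible direction need not have integral 0, so the mass changes along the ray; the
  last condition keeps it positive, as the formula for \<open>I\<close> requires.\<close>

lemma eventually_small: "\<forall>\<^sub>F t in at_right 0. 0 < t \<and> t * M \<le> inverse R \<and> 1 + t * (\<integral>x. \<sigma> x \<partial>lborel) > 0"
proof (intro eventually_conj)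
  show "\<forall>\<^sub>F t :: real in at_right 0. 0 < t" by (simp add: eventually_at_right_less)
  have "((\<lambda>t. t * M) \<longlongrightarrow> 0 * M) (at_right 0)" by (intro tendsto_intros)
  then have "\<forall>\<^sub>F t in at_right 0. t * M < inverse R"
    using R_pos by (intro order_tendstoD(2)[of _ "0 * M"]) auto
  then show "\<forall>\<^sub>F t in at_right 0. t * M \<le> inverse R" by eventually_elim simp
  have "((\<lambda>t. 1 + t * (\<integral>x. \<sigma> x \<partial>lborel)) \<longlongrightarrow> 1 + 0 * (\<integral>x. \<sigma> x \<partial>lborel)) (at_right 0)"
    by (intro tendsto_intros)
  then show "\<forall>\<^sub>F t in at_right 0. 1 + t * (\<integral>x. \<sigma> x \<partial>lborel) > 0"
    by (intro order_tendstoD(1)[of _ "1 + 0 * (\<integral>x. \<sigma> x \<partial>lborel)"]) auto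
qed

lemma integrable_perturbed: "integrable lborel (\<lambda>x. \<rho> x + t * \<sigma> x)"
  using \<rho>_integral integrable_\<sigma> by simp

lemma integral_perturbed: "(\<integral>x. \<rho> x + t * \<sigma> x \<partial>lborel) = 1 + t * (\<integral>x. \<sigma> x \<partial>lborel)"
  using \<rho>_integral integrable_\<sigma> by simp

lemma kinetic_perturbed_finite: "\<forall>\<^sub>F t in at_right 0. kinetic J (\<lambda>x. \<rho> x + t * \<sigma> x) \<noteq> \<infinity>"
  using eventually_small
proof eventually_elim
  case (elim t)
  then show ?case
    by (intro kinetic_finite perturbed_nonneg integrable_perturbed) (auto simp only: integral_perturbed)
qed

text \<open>The second moment of \<open>\<sigma>\<close> is finite, so a finite moment of the
  perturbed density would give one for \<open>\<rho>\<close>.\<close>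

lemma I_perturbed_infinite:
  assumes inf: "I \<rho> = \<infinity>" and t: "0 \<le> t" "t * M \<le> inverse R"
  shows "I (\<lambda>x. \<rho> x + t * \<sigma> x) = \<infinity>"
proof (rule ccontr)
  assume "I (\<lambda>x. \<rho> x + t * \<sigma> x) \<noteq> \<infinity>"
  then have "integrable lborel (\<lambda>x. (\<rho> x + t * \<sigma> x) * (r x)\<^sup>2)"
    by (intro integrable_moment_if_I_finite perturbed_nonneg t integrable_perturbed) (simp add: less_top)
  moreover have "integrable lborel (\<lambda>x. t * (\<sigma> x * (r x)\<^sup>2))"
    using integrable_r_power2_\<sigma>[of 0] by simp
  ultimately have "integrable lborel (\<lambda>x. (\<rho> x + t * \<sigma> x) * (r x)\<^sup>2 - t * (\<sigma> x * (r x)\<^sup>2))"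
    by (rule Bochner_Integration.integrable_diff)
  then have "integrable lborel (\<lambda>x. \<rho> x * (r x)\<^sup>2)" by (simp add: algebra_simps)
  then have "I \<rho> < \<infinity>"
    using I_eq[OF \<rho>_nonneg \<rho>_integral(1)] \<rho>_integral(2) by simp
  then show False using inf by simp
qed

lemma kinetic_difference_quotient_tendsto:
  "((\<lambda>t. (enn2real (kinetic J (\<lambda>x. \<rho> x + t * \<sigma> x)) - enn2real (kinetic J \<rho>)) / t)
    \<longlongrightarrow> - (enn2real (ennreal (J\<^sup>2) / (2 * (I \<rho>)\<^sup>2)) * (\<integral>x. \<sigma> x * (r (x - xbar \<rho>))\<^sup>2 \<partial>lborel))) (at_right 0)"
proof (cases "I \<rho> = \<infinity>")
  case True
  have "\<forall>\<^sub>F t in at_right 0. 0 = (enn2real (kinetic J (\<lambda>x. \<rho> x + t * \<sigma> x)) - enn2real (kinetic J \<rho>)) / t"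
    using eventually_small
  proof eventually_elim
    case (elim t)
    then show ?case using I_perturbed_infinite[OF True, of t] True by (simp add: kinetic_def ennreal_mult_top)
  qed
  moreover have "enn2real (ennreal (J\<^sup>2) / (2 * (I \<rho>)\<^sup>2)) = 0"
    using True by (simp add: power2_eq_square ennreal_mult_top)
  ultimately show ?thesis by (simp add: tendsto_eventually eventually_mono)
next
  case False
  then have fin: "I \<rho> < \<infinity>" by (simp add: less_top)
  note \<rho>r = integrable_moment_if_I_finite[OF \<rho>_nonneg \<rho>_integral(1) fin]
  note \<sigma>r = integrable_r_power2_\<sigma>[of 0, simplified]
  define Q m1 m2 q s0 s1 s2 where "Q = (\<integral>x. \<rho> x * (r x)\<^sup>2 \<partial>lborel)"
    and "m1 = (\<integral>x. x $ 1 * \<rho> x \<partial>lborel)" and "m2 = (\<integral>x. x $ 2 * \<rho> x \<partial>lborel)"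
    and "q = (\<integral>x. \<sigma> x * (r x)\<^sup>2 \<partial>lborel)" and "s0 = (\<integral>x. \<sigma> x \<partial>lborel)"
    and "s1 = (\<integral>x. x $ 1 * \<sigma> x \<partial>lborel)" and "s2 = (\<integral>x. x $ 2 * \<sigma> x \<partial>lborel)"
  \<comment> \<open>This is \<open>I_eq\<close> for the perturbed density: each integral is affine
    in \<open>t\<close> and \<open>\<rho>\<close> has mass 1. The number \<open>D\<close> below is
    the derivative of \<open>N\<close> at 0.\<close>
  define N where "N t = (Q + t * q) - ((m1 + t * s1)\<^sup>2 + (m2 + t * s2)\<^sup>2) / (1 + t * s0)" for t
  define D where "D = q - 2 * m1 * s1 - 2 * m2 * s2 + (m1\<^sup>2 + m2\<^sup>2) * s0"
  have I_N: "I (\<lambda>x. \<rho> x + t * \<sigma> x) = ennreal (N t)" if t: "0 \<le> t" "t * M \<le> inverse R" "1 + t * s0 > 0" for t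
  proof -
    have i: "integrable lborel (\<lambda>x. \<rho> x * (r x)\<^sup>2 + t * (\<sigma> x * (r x)\<^sup>2))" using \<rho>r \<sigma>r by simp
    have "(\<integral>x. (\<rho> x + t * \<sigma> x) * (r x)\<^sup>2 \<partial>lborel) = Q + t * q"
    proof -
      have "(\<integral>x. (\<rho> x + t * \<sigma> x) * (r x)\<^sup>2 \<partial>lborel) = (\<integral>x. \<rho> x * (r x)\<^sup>2 + t * (\<sigma> x * (r x)\<^sup>2) \<partial>lborel)"
        by (simp add: algebra_simps)
      then show ?thesis using \<rho>r \<sigma>r by (simp add: Q_def q_def)
    qed
    moreover have "(\<integral>x. x $ 1 * (\<rho> x + t * \<sigma> x) \<partial>lborel) = m1 + t * s1"
    proof -
      have "(\<integral>x. x $ 1 * (\<rho> x + t * \<sigma> x) \<partial>lborel) = (\<integral>x. x $ 1 * \<rho> x + t * (x $ 1 * \<sigma> x) \<partial>lborel)"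
        by (simp add: algebra_simps)
      then show ?thesis
        using integrable_first_moment1[OF \<rho>_integral(1) \<rho>r] integrable_first_moment1[OF integrable_\<sigma> \<sigma>r]
        by (simp add: m1_def s1_def)
    qed
    moreover have "(\<integral>x. x $ 2 * (\<rho> x + t * \<sigma> x) \<partial>lborel) = m2 + t * s2"
    proof -
      have "(\<integral>x. x $ 2 * (\<rho> x + t * \<sigma> x) \<partial>lborel) = (\<integral>x. x $ 2 * \<rho> x + t * (x $ 2 * \<sigma> x) \<partial>lborel)"
        by (simp add: algebra_simps)
      then show ?thesis
        using integrable_first_moment2[OF \<rho>_integral(1) \<rho>r] integrable_first_moment2[OF integrable_\<sigma> \<sigma>r]
        by (simp add: m2_def s2_def)
    qed
    moreover have "(\<integral>x. \<rho> x + t * \<sigma> x \<partial>lborel) = 1 + t * s0"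
      unfolding s0_def by (rule integral_perturbed)
    moreover have "integrable lborel (\<lambda>x. (\<rho> x + t * \<sigma> x) * (r x)\<^sup>2)"
      using i by (simp add: algebra_simps)
    ultimately show ?thesis
      using I_eq[OF perturbed_nonneg[OF t(1,2)] integrable_perturbed] t(3) by (simp add: N_def)
  qed
  have I0: "I \<rho> = ennreal (N 0)" using I_N[of 0] R_pos by simp
  have N0: "N 0 > 0"
    using I_nonzero[OF \<rho>_nonneg \<rho>_integral(1)] \<rho>_integral(2) I0 by (simp add: ennreal_eq_0_iff not_le)
  have N': "(N has_real_derivative D) (at 0)"
    unfolding N_def D_def
    by (auto intro!: derivative_eq_intros simp: power2_eq_square algebra_simps)
  define \<phi> where "\<phi> t = J\<^sup>2 / (2 * N t)" for t
  have \<phi>': "(\<phi> has_real_derivative - (J\<^sup>2 / (2 * (N 0)\<^sup>2) * D)) (at 0)"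
    unfolding \<phi>_def using N0
    by (auto intro!: derivative_eq_intros N' simp: power2_eq_square field_simps)
  have "isCont N 0" using N' by (rule DERIV_isCont)
  then have "(N \<longlongrightarrow> N 0) (at_right 0)"
    unfolding isCont_def by (rule tendsto_within_subset) auto
  then have evN: "\<forall>\<^sub>F t in at_right 0. N t > 0" using N0 by (rule order_tendstoD(1))
  have "((\<lambda>t. (\<phi> t - \<phi> 0) / t) \<longlongrightarrow> - (J\<^sup>2 / (2 * (N 0)\<^sup>2) * D)) (at_right 0)"
    using has_field_derivative_at_within[OF \<phi>', of "{0<..}"] by (simp add: has_field_derivative_iff)
  moreover have "\<forall>\<^sub>F t in at_right 0. (\<phi> t - \<phi> 0) / t
      = (enn2real (kinetic J (\<lambda>x. \<rho> x + t * \<sigma> x)) - enn2real (kinetic J \<rho>)) / t"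
    using eventually_small evN
  proof eventually_elim
    case (elim t)
    then have "kinetic J (\<lambda>x. \<rho> x + t * \<sigma> x) = ennreal (\<phi> t)"
      unfolding \<phi>_def by (intro kinetic_eq_ennreal I_N) (auto simp: s0_def)
    moreover have "kinetic J \<rho> = ennreal (\<phi> 0)" unfolding \<phi>_def by (intro kinetic_eq_ennreal I0 N0)
    ultimately show ?case using elim N0 by (simp add: \<phi>_def)
  qed
  ultimately have "((\<lambda>t. (enn2real (kinetic J (\<lambda>x. \<rho> x + t * \<sigma> x)) - enn2real (kinetic J \<rho>)) / t)
      \<longlongrightarrow> - (J\<^sup>2 / (2 * (N 0)\<^sup>2) * D)) (at_right 0)"
    by (rule Lim_transform_eventually)
  \<comment> \<open>The motion of the center of mass has no first order effect, since the second
    moment of \<open>\<rho>\<close> is stationary at its center; what remains is the moment of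
    \<open>\<sigma>\<close> about the fixed \<open>xbar \<rho>\<close>.\<close>
  moreover have "D = (\<integral>x. \<sigma> x * (r (x - xbar \<rho>))\<^sup>2 \<partial>lborel)"
    unfolding integral_shifted_moment[OF integrable_\<sigma> \<sigma>r]
    by (simp add: D_def xbar_def \<rho>_integral(2) r_power2 q_def m1_def m2_def s0_def s1_def s2_def)
  moreover have "enn2real (ennreal (J\<^sup>2) / (2 * (I \<rho>)\<^sup>2)) = J\<^sup>2 / (2 * (N 0)\<^sup>2)"
  proof -
    have "2 * (ennreal (N 0))\<^sup>2 = ennreal (2 * (N 0)\<^sup>2)"
      using N0 by (simp add: ennreal_mult ennreal_power)
    then show ?thesis using N0 by (simp add: I0 divide_ennreal)
  qed
  ultimately show ?thesis by simp
qed

end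

section \<open>Variation of the total energy\<close>

lemma E_eq_ereal:
  assumes "U p f \<noteq> \<infinity>" "kinetic J f \<noteq> \<infinity>"
  shows "E p J f = ereal (enn2real (U p f) - 1/2 * G f f + enn2real (kinetic J f))"
proof -
  have "enn2ereal x = ereal (enn2real x)" if "x \<noteq> \<infinity>" for x
    using that by (cases x) auto
  then show ?thesis using assms unfolding E_def kinetic_def[symmetric] by simp
qed

lemma U_finite_if_bounded:
  assumes F1: "F1 p" and F2: "F2 p" and f: "has_bochner_integral lborel f m"
    and bounds: "\<And>x. 0 \<le> f x" "\<And>x. f x \<le> K"
  shows "U p f < \<infinity>"
proof -
  have "U p f \<le> (\<integral>\<^sup>+x. ennreal (specific_A p K * f x) \<partial>lborel)"
    unfolding U_def using bounds by (intro nn_integral_mono ennreal_leI A_le_linear[OF F1 F2]) auto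
  also have "\<dots> = ennreal (\<integral>x. specific_A p K * f x \<partial>lborel)"
    using f bounds specific_A_nonneg[OF F1 F2] by (intro nn_integral_eq_integral) (auto simp: has_bochner_integral_iff)
  also have "\<dots> < \<infinity>" by simp
  finally show ?thesis .
qed

lemma minimizer_U_finite:
  assumes F1: "F1 p" and F2: "F2 p" and min: "minimizes_locally p J \<rho>"
  shows "U p \<rho> < \<infinity>"
proof -
  obtain \<delta> where \<rho>: "\<rho> \<in> R_set" and \<delta>: "\<delta> > 0"
    and le: "\<And>\<kappa>. \<kappa> \<in> R_set \<Longrightarrow> W_inf \<rho> \<kappa> < ereal \<delta> \<Longrightarrow> E p J \<rho> \<le> E p J \<kappa>"
    using min by (auto simp: minimizes_locally_def)
  have "\<delta> / 2 > 0" using \<delta> by simp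
  then obtain \<kappa> K where \<kappa>: "\<kappa> \<in> R_set" "W_inf \<rho> \<kappa> \<le> ereal (\<delta> / 2)" "\<And>x. 0 \<le> \<kappa> x" "\<And>x. \<kappa> x \<le> K"
    by (rule bounded_approx_W_inf[OF \<rho>]) blast
  have int: "has_bochner_integral lborel \<kappa> 1" using \<kappa>(1) by (simp add: R_set_def)
  have "U p \<kappa> < \<infinity>" by (rule U_finite_if_bounded[OF F1 F2 int \<kappa>(3,4)])
  moreover have "kinetic J \<kappa> \<noteq> \<infinity>"
    using int \<kappa>(3) by (intro kinetic_finite) (auto simp: has_bochner_integral_iff)
  ultimately have "E p J \<kappa> < \<infinity>" by (subst E_eq_ereal) auto
  moreover have "ereal (\<delta> / 2) < ereal \<delta>" using \<delta> by simp
  then have "E p J \<rho> \<le> E p J \<kappa>" using \<kappa>(1,2) by (intro le) (auto intro: le_less_trans)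
  ultimately have "E p J \<rho> < \<infinity>" by (rule le_less_trans[rotated])
  \<comment> \<open>The \<open>G\<close> term is a real number and the kinetic term is nonnegative,
    so neither could compensate \<open>U p \<rho> = \<infinity>\<close>.\<close>
  then show ?thesis
    by (cases "U p \<rho>"; cases "ennreal (J\<^sup>2) / (2 * I \<rho>)") (auto simp: E_def)
qed

context admissible_perturbation
begin

lemma G_difference_quotient_tendsto:
  "((\<lambda>t. (G (\<lambda>x. \<rho> x + t * \<sigma> x) (\<lambda>x. \<rho> x + t * \<sigma> x) - G \<rho> \<rho>) / t) \<longlongrightarrow> 2 * G \<rho> \<sigma>) (at_right 0)"
proof -
  have X: "\<rho> \<in> X_set" using \<rho> R_set_subset_X_set by auto
  have "((\<lambda>t. 2 * G \<rho> \<sigma> + t * G \<sigma> \<sigma>) \<longlongrightarrow> 2 * G \<rho> \<sigma> + 0 * G \<sigma> \<sigma>) (at_right 0)"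
    by (intro tendsto_intros)
  then have "((\<lambda>t. 2 * G \<rho> \<sigma> + t * G \<sigma> \<sigma>) \<longlongrightarrow> 2 * G \<rho> \<sigma>) (at_right 0)" by simp
  then show ?thesis
  proof (rule Lim_transform_eventually)
    show "\<forall>\<^sub>F t in at_right 0. 2 * G \<rho> \<sigma> + t * G \<sigma> \<sigma>
        = (G (\<lambda>x. \<rho> x + t * \<sigma> x) (\<lambda>x. \<rho> x + t * \<sigma> x) - G \<rho> \<rho>) / t"
      using eventually_at_right_less[of 0]
    proof eventually_elim
      case (elim t)
      then show ?case
        unfolding G_perturbed[OF X \<sigma>_in_X_set perturbed_in_X_set] by (simp add: field_simps power2_eq_square)
    qed
  qed
qed

context
  fixes p assumes F1: "F1 p" and F2: "F2 p" and U: "U p \<rho> < \<infinity>"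
begin

lemma
  fixes J :: real
  shows integrable_E'_mult: "integrable lborel (\<lambda>x. E' p J \<rho> x * \<sigma> x)"
    and integral_E'_mult: "(\<integral>x. E' p J \<rho> x * \<sigma> x \<partial>lborel) = (\<integral>x. A' p (\<rho> x) * \<sigma> x \<partial>lborel) - G \<rho> \<sigma>
      - enn2real (ennreal (J\<^sup>2) / (2 * (I \<rho>)\<^sup>2)) * (\<integral>x. \<sigma> x * (r (x - xbar \<rho>))\<^sup>2 \<partial>lborel)"
proof -
  let ?c = "enn2real (ennreal (J\<^sup>2) / (2 * (I \<rho>)\<^sup>2))"
  have X: "\<rho> \<in> X_set" using \<rho> R_set_subset_X_set by auto
  have eq: "(\<lambda>x. E' p J \<rho> x * \<sigma> x)
      = (\<lambda>x. A' p (\<rho> x) * \<sigma> x - V \<rho> x * \<sigma> x - ?c * (\<sigma> x * (r (x - xbar \<rho>))\<^sup>2))"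
    by (auto simp: E'_def algebra_simps)
  note i = integrable_A'_mult[OF F1 F2 U] integrable_V_mult[OF X \<sigma>_in_X_set] integrable_r_power2_\<sigma>[of "xbar \<rho>"]
  show "integrable lborel (\<lambda>x. E' p J \<rho> x * \<sigma> x)" unfolding eq using i by simp
  show "(\<integral>x. E' p J \<rho> x * \<sigma> x \<partial>lborel) = (\<integral>x. A' p (\<rho> x) * \<sigma> x \<partial>lborel) - G \<rho> \<sigma>
      - ?c * (\<integral>x. \<sigma> x * (r (x - xbar \<rho>))\<^sup>2 \<partial>lborel)"
    unfolding eq G_def using i by simp
qed

lemma kinetic_\<rho>_finite: "kinetic J \<rho> \<noteq> \<infinity>"
  by (rule kinetic_finite[OF \<rho>_nonneg \<rho>_integral(1)]) (simp add: \<rho>_integral(2))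

text \<open>For small \<open>t\<close> all three parts of the energy are finite, so the extended
  real quotient is the sum of three real ones. The factor 2 from the quadratic form \<open>G\<close>
  cancels the \<open>1/2\<close>.\<close>

lemma E_difference_quotient_tendsto:
  "((\<lambda>t. (E p J (\<lambda>x. \<rho> x + t * \<sigma> x) - E p J \<rho>) / ereal t)
    \<longlongrightarrow> ereal (\<integral>x. E' p J \<rho> x * \<sigma> x \<partial>lborel)) (at_right 0)"
proof -
  let ?f = "\<lambda>t x. \<rho> x + t * \<sigma> x"
  let ?q = "\<lambda>t. (enn2real (U p (?f t)) - enn2real (U p \<rho>)) / t - 1/2 * ((G (?f t) (?f t) - G \<rho> \<rho>) / t)
      + (enn2real (kinetic J (?f t)) - enn2real (kinetic J \<rho>)) / t"
  have "(?q \<longlongrightarrow> (\<integral>x. A' p (\<rho> x) * \<sigma> x \<partial>lborel) - 1/2 * (2 * G \<rho> \<sigma>)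
      + - (enn2real (ennreal (J\<^sup>2) / (2 * (I \<rho>)\<^sup>2)) * (\<integral>x. \<sigma> x * (r (x - xbar \<rho>))\<^sup>2 \<partial>lborel))) (at_right 0)"
    by (intro tendsto_intros U_difference_quotient_tendsto[OF F1 F2 U] G_difference_quotient_tendsto
          kinetic_difference_quotient_tendsto)
  then have "(?q \<longlongrightarrow> (\<integral>x. E' p J \<rho> x * \<sigma> x \<partial>lborel)) (at_right 0)"
    by (simp add: integral_E'_mult)
  then have "((\<lambda>t. ereal (?q t)) \<longlongrightarrow> ereal (\<integral>x. E' p J \<rho> x * \<sigma> x \<partial>lborel)) (at_right 0)"
    by (intro tendsto_intros)
  then show ?thesis
  proof (rule Lim_transform_eventually)
    show "\<forall>\<^sub>F t in at_right 0. ereal (?q t) = (E p J (?f t) - E p J \<rho>) / ereal t"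
      using eventually_small kinetic_perturbed_finite[of J]
    proof eventually_elim
      case (elim t)
      then have "U p (?f t) \<noteq> \<infinity>" by (subst U_perturbed[OF F1 F2 U]) auto
      then have Et: "E p J (?f t) = ereal (enn2real (U p (?f t)) - 1/2 * G (?f t) (?f t) + enn2real (kinetic J (?f t)))"
        using elim by (intro E_eq_ereal) auto
      have E0: "E p J \<rho> = ereal (enn2real (U p \<rho>) - 1/2 * G \<rho> \<rho> + enn2real (kinetic J \<rho>))"
        using U kinetic_\<rho>_finite by (intro E_eq_ereal) auto
      show ?case unfolding Et E0 using elim by (simp add: field_simps)
    qed
  qed
qed

end

end

interpretation fun_space: module fun_scale
  by unfold_locales (auto simp: fun_scale_def fun_eq_iff algebra_simps)

text \<open>The derivative must be linear on the span, while convergence of the integral is known on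
  the cone only; the functions for which it converges form a subspace.\<close>

lemma integrable_mult_fun_span:
  assumes Q: "\<And>\<sigma>. \<sigma> \<in> Q \<Longrightarrow> integrable lborel (\<lambda>x. h x * \<sigma> x)" and f: "f \<in> fun_span Q"
  shows "integrable lborel (\<lambda>x. h x * f x)"
  using f
proof (rule fun_space.span_induct)
  show "fun_space.subspace {f. integrable lborel (\<lambda>x. h x * f x)}"
    unfolding fun_space.subspace_def
    by (auto simp: fun_scale_def distrib_left mult.left_commute)
qed (rule Q)

lemma linear_functional_on_integral:
  assumes "\<And>\<sigma>. \<sigma> \<in> Q \<Longrightarrow> integrable lborel (\<lambda>x. h x * \<sigma> x)"
  shows "linear_functional_on (fun_span Q) (\<lambda>\<sigma>. \<integral>x. h x * \<sigma> x \<partial>lborel)"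
  unfolding linear_functional_on_def
proof (intro conjI ballI allI impI)
  fix f g assume "f \<in> fun_span Q" "g \<in> fun_span Q"
  then have i: "integrable lborel (\<lambda>x. h x * f x)" "integrable lborel (\<lambda>x. h x * g x)"
    using integrable_mult_fun_span[OF assms] by auto
  show "(\<integral>x. h x * (a * f x + b * g x) \<partial>lborel) = a * (\<integral>x. h x * f x \<partial>lborel) + b * (\<integral>x. h x * g x \<partial>lborel)" for a b
  proof -
    have "(\<integral>x. h x * (a * f x + b * g x) \<partial>lborel) = (\<integral>x. a * (h x * f x) + b * (h x * g x) \<partial>lborel)"
      by (intro Bochner_Integration.integral_cong) (auto simp: algebra_simps)
    then show ?thesis using i by simp
  qed
  assume "AE x in lborel. f x = g x"
  then have "AE x in lborel. h x * f x = h x * g x" by eventually_elim simp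
  then show "(\<integral>x. h x * f x \<partial>lborel) = (\<integral>x. h x * g x \<partial>lborel)"
    using i by (intro integral_cong_AE) auto
qed

theorem lemma5p6:
  fixes p :: "real \<Rightarrow> real" and J :: real and \<rho> :: "space3 \<Rightarrow> real"
  assumes "F1 p" and "F2 p" and "F3 p"
    and "J \<ge> 0"
    and "minimizes_locally p J \<rho>"
  shows "\<bar>E p J \<rho>\<bar> \<noteq> \<infinity> \<and> \<rho> \<in> W_set p
    \<and> E_differentiable p J (P_inf \<rho>) \<rho>
    \<and> has_E_derivative p J (P_inf \<rho>) \<rho> (\<lambda>\<sigma>. \<integral>x. E' p J \<rho> x * \<sigma> x \<partial>lborel)
    \<and> (\<forall>\<sigma>\<in>P_inf \<rho>. integrable lborel (\<lambda>x. E' p J \<rho> x * \<sigma> x))"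
proof -
  have \<rho>: "\<rho> \<in> R_set" using assms(5) by (simp add: minimizes_locally_def)
  then have \<rho>': "\<rho> \<in> X_set" "AE x in lborel. 0 \<le> \<rho> x" "has_bochner_integral lborel \<rho> 1"
    using R_set_subset_X_set by (auto simp: R_set_def)
  have U: "U p \<rho> < \<infinity>" by (rule minimizer_U_finite[OF assms(1,2,5)])
  have kin: "kinetic J \<rho> \<noteq> \<infinity>"
    using \<rho>'(2,3) by (intro kinetic_finite) (auto simp: has_bochner_integral_iff)
  have "\<bar>E p J \<rho>\<bar> \<noteq> \<infinity>" using U kin by (subst E_eq_ereal) auto
  moreover have "\<rho> \<in> W_set p" using \<rho>' U by (simp add: W_set_def U_set_def)
  \<comment> \<open>Integrability ensures that the derivative formula is not the default value 0 of
    a divergent integral, and it gives linearity on the span.\<close>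
  moreover have int: "integrable lborel (\<lambda>x. E' p J \<rho> x * \<sigma> x)" if "\<sigma> \<in> P_inf \<rho>" for \<sigma>
    using P_inf_admissible[OF \<rho> that] admissible_perturbation.integrable_E'_mult[OF _ assms(1,2) U] by metis
  moreover have "has_E_derivative p J (P_inf \<rho>) \<rho> (\<lambda>\<sigma>. \<integral>x. E' p J \<rho> x * \<sigma> x \<partial>lborel)"
    unfolding has_E_derivative_def
  proof (intro conjI ballI subsetI)
    fix \<sigma> assume \<sigma>: "\<sigma> \<in> P_inf \<rho>"
    obtain R M where "admissible_perturbation \<rho> \<sigma> R M" using P_inf_admissible[OF \<rho> \<sigma>] .
    then interpret admissible_perturbation \<rho> \<sigma> R M .
    show "\<sigma> \<in> X_set" by (rule \<sigma>_in_X_set)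
    show "((\<lambda>t. (E p J (\<lambda>x. \<rho> x + t * \<sigma> x) - E p J \<rho>) / ereal t)
        \<longlongrightarrow> ereal (\<integral>x. E' p J \<rho> x * \<sigma> x \<partial>lborel)) (at_right 0)"
      by (rule E_difference_quotient_tendsto[OF assms(1,2) U])
    have "(\<lambda>x. \<rho> x + t * \<sigma> x) \<in> U_set p" if t: "0 \<le> t" "t < inverse R / M" for t
      using t M_pos by (intro perturbed_in_U_set[OF assms(1,2) U]) (auto simp: less_divide_eq)
    moreover have "0 < inverse R / M" using R_pos M_pos by simp
    ultimately show "\<sigma> \<in> P_dirs p \<rho>" unfolding P_dirs_def using \<sigma>_in_X_set by blast
  next
    show "fun_cone (P_inf \<rho>)" by (rule fun_cone_P_inf)
    show "linear_functional_on (fun_span (P_inf \<rho>)) (\<lambda>\<sigma>. \<integral>x. E' p J \<rho> x * \<sigma> x \<partial>lborel)"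
      by (rule linear_functional_on_integral[OF int])
  qed
  ultimately show ?thesis unfolding E_differentiable_def by blast
qed

end
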